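(* Let $0<\nu<1$, $T>0$, and let $f$ satisfy $|f(x,y^* )-f(x,y^{**})|\le L|y^*-y^{**}|$ for all $x\in[0,T]$ and all $y^*,y^{**}\in\mathbb{R}$, with a constant $L>0$. Let $y$ be the exact solution of the initial value problem ${}_0D_x^\nu y(x)=f(x,y(x))$, $0<x\le T$, $y(0)=y_0$, and assume $y\in C^3[0,T]$. Let $\pi_B=9$. Then there exists a constant $K$, depending on $\nu$, $L$, $T$ and the solution $y$ (but not on the step size), such that the following holds: for every positive integer $N$ for which $\Delta x=T/(2N)$ satisfies $$\Delta x^{\nu}\le\frac{1}{24\pi_BL},$$ and for $\{y_k\}_{k=0}^{2N}$ the numerical solution obtained by the scheme ${}_0D_{\Delta x}^\nu y_j=f(x_j,y_j)$, $j=1,\dots,2N$, with initial value $y_0$, one has $$|y(x_k)-y_k|\le K\Delta x^{3-\nu}\qquad\text{for all }k=1,2,\dots,2N.$$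
   Context: Kernel: $\omega_{1-\nu}(x)=x^{-\nu}/\Gamma(1-\nu)$. Caputo derivative: ${}_0D_x^\nu y(x)=\int_0^x\omega_{1-\nu}(x-s)y'(s)\,ds$. Grid: $x_j=j\Delta x$, $j=0,1,\dots,2N$. Discrete Caputo derivative. For grid values $z_0,\dots,z_{2N}$, let $I_{[x_i,x_{i+2}]}z$ be the polynomial of degree at most 2 taking the values $z_i,z_{i+1},z_{i+2}$ at $x_i,x_{i+1},x_{i+2}$. Define the piecewise quadratic function $\Pi_j z$ on $[0,x_j]$ by: - for $j=1,2$: $\Pi_j z=I_{[x_0,x_2]}z$ on $[0,x_j]$; - for $j=2m+1$, $1\le m\le N-1$: $\Pi_jz=I_{[x_0,x_2]}z$ on $[x_0,x_1]$ and $\Pi_jz=I_{[x_{2k-1},x_{2k+1}]}z$ on $[x_{2k-1},x_{2k+1}]$ for $k=1,\dots,m$; - for $j=2m+2$, $1\le m\le N-1$: $\Pi_jz=I_{[x_{2k},x_{2k+2}]}z$ on $[x_{2k},x_{2k+2}]$ for $k=0,\dots,m$. Then ${}_0D_{\Delta x}^{\nu}z_j=\int_0^{x_j}(\Pi_jz)'(s)\,\omega_{1-\nu}(x_j-s)\,ds$ for $j=1,\dots,2N$ (derivative taken piecewise). Note that ${}_0D_{\Delta x}^{\nu}z_1$ involves $z_2$. *)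

theory Defs
  imports "HOL-Analysis.Analysis" "HOL-Computational_Algebra.Polynomial"
begin

text \<open>\<^term>\<open>f\<close> is \<^term>\<open>k\<close> times continuously differentiable on \<^term>\<open>S\<close>. Derivatives are taken
  within \<^term>\<open>S\<close>, so they are one-sided at the endpoints of a closed interval.\<close>

definition C_k_on :: "nat \<Rightarrow> (real \<Rightarrow> real) \<Rightarrow> real set \<Rightarrow> bool" where
  "C_k_on k f S \<longleftrightarrow>
     (\<exists>D. D 0 = f \<and>
          (\<forall>i<k. \<forall>x\<in>S. (D i has_real_derivative D (Suc i) x) (at x within S)) \<and>
          (\<forall>i\<le>k. continuous_on S (D i)))"

text \<open>The kernel \<open>\<omega>\<close> with index \<open>1 - \<nu>\<close>. Its value at \<open>0\<close>, where \<open>powr\<close> gives \<open>0\<close>, does not affect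
  the integrals below.\<close>

definition kernel :: "real \<Rightarrow> real \<Rightarrow> real" where
  "kernel \<nu> x = x powr (- \<nu>) / Gamma (1 - \<nu>)"

definition caputo :: "real \<Rightarrow> (real \<Rightarrow> real) \<Rightarrow> real \<Rightarrow> real" where
  "caputo \<nu> y x =
     integral {0..x} (\<lambda>s. kernel \<nu> (x - s) * vector_derivative y (at s within {0..x}))"

definition grid :: "real \<Rightarrow> nat \<Rightarrow> real" where
  "grid h j = real j * h"

definition quad_interp :: "real \<Rightarrow> (nat \<Rightarrow> real) \<Rightarrow> nat \<Rightarrow> real poly" where
  "quad_interp h z i =
     (THE p. degree p \<le> 2 \<and> (\<forall>k\<in>{i, i + 1, i + 2}. poly p (grid h k) = z k))"

text \<open>The polynomial that represents \<open>\<Pi>\<^sub>j z\<close> near \<^term>\<open>s\<close>. The \<open>LEAST\<close> finds the index \<open>k\<close> of the piece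
  containing \<^term>\<open>s\<close>; at a node shared by two pieces it picks the left one, which is immaterial for
  \<open>\<Pi>\<^sub>j z\<close> (both pieces interpolate there) and for integrals of its derivative.\<close>

definition piece :: "real \<Rightarrow> (nat \<Rightarrow> real) \<Rightarrow> nat \<Rightarrow> real \<Rightarrow> real poly" where
  "piece h z j s =
     (if j \<le> 2 then quad_interp h z 0
      else if odd j then
        (if s \<le> grid h 1 then quad_interp h z 0
         else quad_interp h z (2 * (LEAST k. s \<le> grid h (2 * k + 1)) - 1))
      else quad_interp h z (2 * (LEAST k. s \<le> grid h (2 * k + 2))))"

definition Pi_interp :: "real \<Rightarrow> (nat \<Rightarrow> real) \<Rightarrow> nat \<Rightarrow> real \<Rightarrow> real" where
  "Pi_interp h z j s = poly (piece h z j s) s"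

definition Pi_interp_deriv :: "real \<Rightarrow> (nat \<Rightarrow> real) \<Rightarrow> nat \<Rightarrow> real \<Rightarrow> real" where
  "Pi_interp_deriv h z j s = poly (pderiv (piece h z j s)) s"

definition caputo_discrete :: "real \<Rightarrow> real \<Rightarrow> (nat \<Rightarrow> real) \<Rightarrow> nat \<Rightarrow> real" where
  "caputo_discrete \<nu> h z j =
     integral {0..grid h j} (\<lambda>s. Pi_interp_deriv h z j s * kernel \<nu> (grid h j - s))"

definition numerical_solution ::
  "real \<Rightarrow> (real \<Rightarrow> real \<Rightarrow> real) \<Rightarrow> real \<Rightarrow> real \<Rightarrow> nat \<Rightarrow> (nat \<Rightarrow> real) \<Rightarrow> bool" where
  "numerical_solution \<nu> f y0 h N z \<longleftrightarrow>
     z 0 = y0 \<and> (\<forall>j\<in>{1..2 * N}. caputo_discrete \<nu> h z j = f (grid h j) (z j))"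

definition pi_B :: real where
  "pi_B = 9"

text \<open>The description in \<^const>\<open>quad_interp\<close> is proper, and \<^const>\<open>Pi_interp\<close> is the prescribed
  interpolant on each closed piece.\<close>

lemma quad_interp_unique:
  assumes "h > 0"
  shows "\<exists>!p. degree p \<le> 2 \<and> (\<forall>k\<in>{i, i + 1, i + 2}. poly p (grid h k) = z k)"
proof (rule ex_ex1I)
  let ?a = "grid h i"
  define d1 where "d1 = (z (i + 1) - z i) / h"
  define d2 where "d2 = (z (i + 2) - 2 * z (i + 1) + z i) / (2 * h\<^sup>2)"
  define p where "p = [:z i:] + smult d1 [:- ?a, 1:] + smult d2 ([:- ?a, 1:] * [:- (?a + h), 1:])"
  have "degree p \<le> 2" by (simp add: p_def)
  moreover have "poly p (grid h k) = z k" if "k \<in> {i, i + 1, i + 2}" for k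
    using that assms unfolding p_def d1_def d2_def grid_def
    by (auto simp: field_simps power2_eq_square)
  ultimately show "\<exists>p. degree p \<le> 2 \<and> (\<forall>k\<in>{i, i + 1, i + 2}. poly p (grid h k) = z k)"
    by blast
next
  fix p q :: "real poly"
  assume p: "degree p \<le> 2 \<and> (\<forall>k\<in>{i, i + 1, i + 2}. poly p (grid h k) = z k)"
    and q: "degree q \<le> 2 \<and> (\<forall>k\<in>{i, i + 1, i + 2}. poly q (grid h k) = z k)"
  have inj: "inj_on (grid h) {i, i + 1, i + 2}"
    using assms by (auto simp: inj_on_def grid_def)
  show "p = q"
  proof (rule ccontr)
    assume ne: "p \<noteq> q"
    then have "finite {x. poly (p - q) x = 0}"
      by (intro poly_roots_finite) simp
    moreover have "grid h ` {i, i + 1, i + 2} \<subseteq> {x. poly (p - q) x = 0}"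
      using p q by auto
    ultimately have "card (grid h ` {i, i + 1, i + 2}) \<le> card {x. poly (p - q) x = 0}"
      by (rule card_mono)
    also have "\<dots> \<le> degree (p - q)"
      by (rule card_poly_roots_bound) (use ne in simp)
    also have "\<dots> \<le> 2" using p q by (simp add: degree_diff_le)
    finally show False using card_image[OF inj] by simp
  qed
qed

lemma quad_interp_poly:
  assumes "h > 0" "k \<in> {i, i + 1, i + 2}"
  shows "degree (quad_interp h z i) \<le> 2" "poly (quad_interp h z i) (grid h k) = z k"
  using theI'[OF quad_interp_unique[OF assms(1), of i z]] assms(2)
  unfolding quad_interp_def by blast+

lemma Least_piece:
  assumes "h > 0" "grid h (2 * k + c) < s" "s \<le> grid h (2 * k + 2 + c)"
  shows "(LEAST k. s \<le> grid h (2 * k + c)) = Suc k"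
proof (rule Least_equality)
  show "s \<le> grid h (2 * Suc k + c)" using assms(3) by simp
  fix l assume "s \<le> grid h (2 * l + c)"
  then have "grid h (2 * k + c) < grid h (2 * l + c)" using assms(2) by linarith
  then have "2 * k + c < 2 * l + c" using assms(1) by (simp add: grid_def)
  then show "Suc k \<le> l" by simp
qed

lemma Pi_interp_small:
  assumes "j \<le> 2"
  shows "Pi_interp h z j s = poly (quad_interp h z 0) s"
  using assms by (simp add: Pi_interp_def piece_def)

lemma Pi_interp_odd_first:
  assumes "m \<ge> 1" "s \<le> grid h 1"
  shows "Pi_interp h z (2 * m + 1) s = poly (quad_interp h z 0) s"
  using assms by (simp add: Pi_interp_def piece_def)

lemma Pi_interp_odd:
  assumes h: "h > 0" and m: "m \<ge> 1" and k: "k \<ge> 1"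
    and s: "s \<in> {grid h (2 * k - 1)..grid h (2 * k + 1)}"
  shows "Pi_interp h z (2 * m + 1) s = poly (quad_interp h z (2 * k - 1)) s"
proof (cases "s = grid h (2 * k - 1)")
  case False
  obtain l where l: "k = Suc l" using k by (cases k) auto
  have *: "grid h (2 * l + 1) < s" using False s l by simp
  have "grid h 1 \<le> grid h (2 * l + 1)" using h by (simp add: grid_def)
  with * have "\<not> s \<le> grid h 1" by linarith
  moreover have "(LEAST k. s \<le> grid h (2 * k + 1)) = k"
    using Least_piece[OF h *] s l by simp
  ultimately show ?thesis using m by (simp add: Pi_interp_def piece_def)
next
  case True
  have R: "poly (quad_interp h z (2 * k - 1)) s = z (2 * k - 1)"
    unfolding True by (rule quad_interp_poly(2)) (use h in auto)
  show ?thesis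
  proof (cases "k = 1")
    case k1: True
    have "poly (quad_interp h z 0) (grid h 1) = z 1"
      by (rule quad_interp_poly(2)) (use h in auto)
    then show ?thesis using R k1 True m by (simp add: Pi_interp_def piece_def)
  next
    case False
    then obtain l where l: "k = Suc (Suc l)" using k
      by (metis One_nat_def not0_implies_Suc not_one_le_zero)
    have *: "grid h (2 * l + 1) < s" and "s \<le> grid h (2 * l + 2 + 1)" "grid h 1 < s"
      using True l h by (auto simp: grid_def)
    then have "Pi_interp h z (2 * m + 1) s = poly (quad_interp h z (2 * l + 1)) s"
      using Least_piece[OF h *] m by (simp add: Pi_interp_def piece_def)
    also have "\<dots> = z (2 * k - 1)"
      unfolding True by (rule quad_interp_poly(2)) (use h l in auto)
    finally show ?thesis using R by simp
  qed
qed

lemma Pi_interp_even: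
  assumes h: "h > 0" and m: "m \<ge> 1"
    and s: "s \<in> {grid h (2 * k)..grid h (2 * k + 2)}"
  shows "Pi_interp h z (2 * m + 2) s = poly (quad_interp h z (2 * k)) s"
proof (cases k)
  case 0
  have "(LEAST k. s \<le> grid h (2 * k + 2)) = 0"
    by (rule Least_equality) (use s 0 in auto)
  then show ?thesis using 0 m by (simp add: Pi_interp_def piece_def)
next
  case (Suc l)
  show ?thesis
  proof (cases "s = grid h (2 * k)")
    case False
    have *: "grid h (2 * l + 2) < s" using False s Suc by simp
    have "(LEAST k. s \<le> grid h (2 * k + 2)) = k"
      using Least_piece[OF h *] s Suc by simp
    then show ?thesis using m by (simp add: Pi_interp_def piece_def)
  next
    case True
    have R: "poly (quad_interp h z (2 * k)) s = z (2 * k)"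
      unfolding True by (rule quad_interp_poly(2)) (use h in auto)
    have "(LEAST k. s \<le> grid h (2 * k + 2)) = l"
    proof (rule Least_equality)
      show "s \<le> grid h (2 * l + 2)" using True Suc by simp
      fix n assume "s \<le> grid h (2 * n + 2)"
      then have "grid h (2 * l + 2) \<le> grid h (2 * n + 2)" using True Suc by simp
      then have "real (2 * l + 2) \<le> real (2 * n + 2)"
        unfolding grid_def using h by (simp only: mult_le_cancel_right_pos)
      then show "l \<le> n" by simp
    qed
    then have "Pi_interp h z (2 * m + 2) s = poly (quad_interp h z (2 * l)) s"
      using m by (simp add: Pi_interp_def piece_def)
    also have "\<dots> = z (2 * k)"
      unfolding True by (rule quad_interp_poly(2)) (use h Suc in auto)
    finally show ?thesis using R by simp
  qed
qed

end

(*
  On every block of two cells the scheme applies the same weights, up to a shift, to the increments of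
  the grid function. Up to a correction on the first cell of the odd steps, it is therefore a discrete
  convolution of the increments with a sequence of weights. For large nu this sequence fails to be
  monotone in its first entries only. Dividing its generating function by 1 - eta x with
  eta = 2 nu / (2 + nu), half of the relative drop from the first weight to the second, yields
  decreasing weights of size at least (k + 5)^(-nu); the error is replaced by
  e_k - eta e_{k-1}. Decreasing weights give a comparison principle, and exp (mu x) with mu large
  is a supersolution, which replaces the discrete fractional Gronwall inequality. The correction is
  harmless because the first two errors gain a factor h^nu from their 2 x 2 system.

  For the truncation error, the derivative of the interpolation error is O(h^2) and has integral zero
  on every piece, so a piece away from the singularity only sees the oscillation of the kernel on it,
  and these oscillations telescope.
*)


theory Submission
  imports Defs
begin

section \<open>Quadrature weights\<close>

text \<open>The obstacle is the second weight: up to a common positive factor the first two weights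
  are \<open>2 + \<nu>\<close> and \<open>2 - 3 * \<nu>\<close>, so the second is negative for
  \<open>\<nu> > 2 / 3\<close>, and for \<open>\<nu>\<close> near 1 the third one exceeds it. With
  the chosen eta the second damped weight is the mean of the first two original ones,
  \<open>2 - \<nu>\<close>, which leaves enough room for the third. From the third on, the original
  weights decrease by themselves, and the recursion preserves this. After multiplication by
  \<open>Gamma (1 - \<nu>) * h powr \<nu>\<close> the Lipschitz term and the residual of the error
  equation both carry \<open>h powr \<nu>\<close>. On the scale of \<open>1 / (mu * h)\<close>
  steps, on which exp (mu x) at least doubles, the weights are at least of order
  \<open>(mu * h) powr \<nu>\<close>. The powers of \<open>h\<close> cancel, so mu can be chosen
  independently of the step size. For the same reason the correction at odd steps, whose weights are
  only known to be bounded, must itself be \<open>h powr \<nu>\<close> times the residual; a bound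
  of the first two errors by the residual alone would not suffice.\<close>

lemma has_integral_powr_affine:
  fixes \<nu> t a b c d :: real
  assumes "\<nu> < 1" "0 \<le> t" "0 \<le> c" "c \<le> d"
  shows "((\<lambda>u. (t + u) powr (- \<nu>) * (a + b * u)) has_integral
           ((a - b * t) * ((t + d) powr (1 - \<nu>) - (t + c) powr (1 - \<nu>)) / (1 - \<nu>) +
            b * ((t + d) powr (2 - \<nu>) - (t + c) powr (2 - \<nu>)) / (2 - \<nu>))) {c..d}"
proof -
  define F where "F = (\<lambda>u. (a - b * t) * (t + u) powr (1 - \<nu>) / (1 - \<nu>) +
    b * (t + u) powr (2 - \<nu>) / (2 - \<nu>))"
  have "((\<lambda>u. (t + u) powr (- \<nu>) * (a + b * u)) has_integral (F d - F c)) {c..d}"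
  \<comment> \<open>The antiderivative comes from
    \<open>a + b * u = (a - b * t) + b * (t + u)\<close>. For \<open>t = 0\<close> and
    \<open>c = 0\<close> the integrand is singular at the left end, so \<open>F\<close> is
    differentiated in the interior only and is merely continuous up to the endpoints.\<close>
  proof (rule fundamental_theorem_of_calculus_interior)
    show "continuous_on {c..d} F"
      unfolding F_def using assms
      by (intro continuous_intros continuous_on_powr') auto
    fix u assume u: "u \<in> {c<..<d}"
    then have p: "t + u > 0" using assms by auto
    have "(F has_real_derivative (a - b * t) * ((1 - \<nu>) * (t + u) powr (1 - \<nu> - 1)) / (1 - \<nu>)
        + b * ((2 - \<nu>) * (t + u) powr (2 - \<nu> - 1)) / (2 - \<nu>)) (at u)"
      unfolding F_def using p assms by (auto intro!: derivative_eq_intros)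
    also have "(a - b * t) * ((1 - \<nu>) * (t + u) powr (1 - \<nu> - 1)) / (1 - \<nu>)
        + b * ((2 - \<nu>) * (t + u) powr (2 - \<nu> - 1)) / (2 - \<nu>)
        = (a - b * t) * (t + u) powr (- \<nu>) + b * (t + u) powr (1 - \<nu>)"
      using assms by simp
    also have "\<dots> = (t + u) powr (- \<nu>) * (a + b * u)"
      using p powr_add[of "t + u" 1 "- \<nu>"] by (simp add: algebra_simps)
    finally have "(F has_real_derivative (t + u) powr (- \<nu>) * (a + b * u)) (at u)" .
    then show "(F has_vector_derivative (t + u) powr (- \<nu>) * (a + b * u)) (at u)"
      by (simp add: has_real_derivative_iff_has_vector_derivative)
  qed (use assms in auto)
  moreover have "F d - F c = (a - b * t) * ((t + d) powr (1 - \<nu>) - (t + c) powr (1 - \<nu>)) / (1 - \<nu>) +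
            b * ((t + d) powr (2 - \<nu>) - (t + c) powr (2 - \<nu>)) / (2 - \<nu>)"
    by (simp add: F_def algebra_simps diff_divide_distrib add_divide_distrib)
  ultimately show ?thesis by simp
qed

text \<open>In units of the step size, and with \<open>u\<close> the distance from the right end of a block, the derivative
  of the quadratic interpolant is \<open>(3/2 - u)\<close> times the increment over the right cell plus \<open>(u - 1/2)\<close> times
  the increment over the left one; \<open>t\<close> is the distance of the block from the evaluation point.\<close>

definition right_weight :: "real \<Rightarrow> real \<Rightarrow> real" where
  "right_weight \<nu> t = integral {0..2} (\<lambda>u. (t + u) powr (- \<nu>) * (3 / 2 - u))"

definition left_weight :: "real \<Rightarrow> real \<Rightarrow> real" where
  "left_weight \<nu> t = integral {0..2} (\<lambda>u. (t + u) powr (- \<nu>) * (u - 1 / 2))"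

text \<open>The cell left over at an odd step sees only the left half of the quadratic on the first
  three nodes. Here \<open>u\<close> is measured from the right end of that cell, and
  \<open>p\<close>, \<open>q\<close> are the increments over the first and the second cell.\<close>

definition first_weight :: "real \<Rightarrow> real \<Rightarrow> real \<Rightarrow> real \<Rightarrow> real" where
  "first_weight \<nu> t p q = integral {0..1} (\<lambda>u. (t + u) powr (- \<nu>) * (p * (u + 1 / 2) + q * (1 / 2 - u)))"

lemma has_integral_right_weight:
  assumes "\<nu> < 1" "0 \<le> t"
  shows "((\<lambda>u. (t + u) powr (- \<nu>) * (3 / 2 - u)) has_integral right_weight \<nu> t) {0..2}"
proof -
  have "(\<lambda>u. (t + u) powr (- \<nu>) * (3 / 2 - u)) integrable_on {0..2}"
    using has_integral_powr_affine[OF assms, of 0 2 "3/2" "-1"] by (auto intro: has_integral_integrable)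
  then show ?thesis unfolding right_weight_def by (rule integrable_integral)
qed

lemma has_integral_left_weight:
  assumes "\<nu> < 1" "0 \<le> t"
  shows "((\<lambda>u. (t + u) powr (- \<nu>) * (u - 1 / 2)) has_integral left_weight \<nu> t) {0..2}"
proof -
  have "(\<lambda>u. (t + u) powr (- \<nu>) * (u - 1 / 2)) integrable_on {0..2}"
    using has_integral_powr_affine[OF assms, of 0 2 "-1/2" "1"]
    by (auto intro: has_integral_integrable simp: algebra_simps)
  then show ?thesis unfolding left_weight_def by (rule integrable_integral)
qed

lemma has_integral_first_weight:
  assumes "\<nu> < 1" "0 \<le> t"
  shows "((\<lambda>u. (t + u) powr (- \<nu>) * (p * (u + 1 / 2) + q * (1 / 2 - u))) has_integral first_weight \<nu> t p q) {0..1}"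
proof -
  have "(\<lambda>u. (t + u) powr (- \<nu>) * ((p + q) / 2 + (p - q) * u)) integrable_on {0..1}"
    using has_integral_powr_affine[OF assms, of 0 1 "(p + q) / 2" "p - q"]
    by (auto intro: has_integral_integrable)
  also have "(\<lambda>u. (t + u) powr (- \<nu>) * ((p + q) / 2 + (p - q) * u)) =
     (\<lambda>u. (t + u) powr (- \<nu>) * (p * (u + 1 / 2) + q * (1 / 2 - u)))"
    by (auto simp: field_simps)
  finally show ?thesis unfolding first_weight_def by (rule integrable_integral)
qed

lemma right_weight_0:
  assumes "0 < \<nu>" "\<nu> < 1"
  shows "right_weight \<nu> 0 = 2 powr (1 - \<nu>) * (2 + \<nu>) / (2 * (1 - \<nu>) * (2 - \<nu>))"
proof -
  have *: "2 powr (2 - \<nu>) = 2 * 2 powr (1 - \<nu>)" using powr_add[of 2 1 "1 - \<nu>"] by simp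
  have "right_weight \<nu> 0 = 3 / 2 * 2 powr (1 - \<nu>) / (1 - \<nu>) - 2 powr (2 - \<nu>) / (2 - \<nu>)"
    by (rule has_integral_unique[OF has_integral_right_weight])
       (use assms has_integral_powr_affine[of \<nu> 0 0 2 "3/2" "-1"] in auto)
  also have "\<dots> = 2 powr (1 - \<nu>) * (2 + \<nu>) / (2 * (1 - \<nu>) * (2 - \<nu>))"
    unfolding * using assms by (simp add: field_simps)
  finally show ?thesis .
qed

lemma left_weight_0:
  assumes "0 < \<nu>" "\<nu> < 1"
  shows "left_weight \<nu> 0 = 2 powr (1 - \<nu>) * (2 - 3 * \<nu>) / (2 * (1 - \<nu>) * (2 - \<nu>))"
proof -
  have *: "2 powr (2 - \<nu>) = 2 * 2 powr (1 - \<nu>)" using powr_add[of 2 1 "1 - \<nu>"] by simp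
  have "left_weight \<nu> 0 = - 1 / 2 * 2 powr (1 - \<nu>) / (1 - \<nu>) + 2 powr (2 - \<nu>) / (2 - \<nu>)"
    by (rule has_integral_unique[OF has_integral_left_weight])
       (use assms has_integral_powr_affine[of \<nu> 0 0 2 "-1/2" "1"] in \<open>auto simp: algebra_simps\<close>)
  also have "\<dots> = 2 powr (1 - \<nu>) * (2 - 3 * \<nu>) / (2 * (1 - \<nu>) * (2 - \<nu>))"
    unfolding * using assms by (simp add: field_simps)
  finally show ?thesis .
qed

lemma first_weight_0:
  assumes "0 < \<nu>" "\<nu> < 1"
  shows "first_weight \<nu> 0 p q = ((4 - 3 * \<nu>) * p + \<nu> * q) / (2 * (1 - \<nu>) * (2 - \<nu>))"
proof -
  have eq: "(\<lambda>u. u powr (- \<nu>) * (p * (u + 1 / 2) + q * (1 / 2 - u))) =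
     (\<lambda>u. u powr (- \<nu>) * ((p + q) / 2 + (p - q) * u))"
    by (auto simp: field_simps)
  have "first_weight \<nu> 0 p q = (p + q) / 2 / (1 - \<nu>) + (p - q) / (2 - \<nu>)"
    by (rule has_integral_unique[OF has_integral_first_weight])
       (use assms has_integral_powr_affine[of \<nu> 0 0 1 "(p + q) / 2" "p - q"] in \<open>auto simp: eq\<close>)
  also have "\<dots> = ((4 - 3 * \<nu>) * p + \<nu> * q) / (2 * (1 - \<nu>) * (2 - \<nu>))"
    using assms by (simp add: divide_simps) (simp add: algebra_simps)
  finally show ?thesis .
qed

lemma right_weight_2:
  assumes "0 < \<nu>" "\<nu> < 1"
  shows "right_weight \<nu> 2 = 2 powr (1 - \<nu>) * ((12 + 2 * \<nu>) * 2 powr (- \<nu>) - 10 + 3 * \<nu>) / (2 * (1 - \<nu>) * (2 - \<nu>))"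
proof -
  define q where "q = 2 powr (- \<nu>)"
  have 4: "4 powr x = 2 powr x * 2 powr x" for x :: real
    using powr_mult[of 2 2 x] by simp
  have *: "2 powr (2 - \<nu>) = 4 * q" "2 powr (1 - \<nu>) = 2 * q"
    using powr_add[of 2 1 "- \<nu>"] powr_add[of 2 2 "- \<nu>"] by (simp_all add: q_def)
  have "right_weight \<nu> 2 = 7 / 2 * (4 powr (1 - \<nu>) - 2 powr (1 - \<nu>)) / (1 - \<nu>)
      + (2 powr (2 - \<nu>) - 4 powr (2 - \<nu>)) / (2 - \<nu>)"
    by (rule has_integral_unique[OF has_integral_right_weight])
       (use assms has_integral_powr_affine[of \<nu> 2 0 2 "3/2" "-1"] in \<open>auto simp: diff_divide_distrib\<close>)
  also have "\<dots> = 2 powr (1 - \<nu>) * ((12 + 2 * \<nu>) * 2 powr (- \<nu>) - 10 + 3 * \<nu>) / (2 * (1 - \<nu>) * (2 - \<nu>))"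
    unfolding 4 * q_def[symmetric] using assms
    by (simp add: divide_simps) (simp add: algebra_simps)
  finally show ?thesis .
qed

text \<open>The difference has the integrand \<open>(t + u) powr (- \<nu>) * (2 - 2 * u)\<close>,
  whose second factor has mean zero and changes sign at \<open>u = 1\<close>. Freezing the
  decreasing power at \<open>u = 1\<close> lowers the integrand on both sides of that point.\<close>

lemma left_weight_le_right_weight:
  assumes "0 < \<nu>" "\<nu> < 1" "0 \<le> t"
  shows "left_weight \<nu> t \<le> right_weight \<nu> t"
proof -
  let ?g = "\<lambda>u. (t + u) powr (- \<nu>) * (3 / 2 - u) - (t + u) powr (- \<nu>) * (u - 1 / 2)"
  have "(?g has_integral right_weight \<nu> t - left_weight \<nu> t) {0..2}"
    using assms by (intro has_integral_diff has_integral_right_weight has_integral_left_weight) auto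
  \<comment> \<open>For \<open>t = 0\<close> the default value \<open>0 powr (- \<nu>) = 0\<close>
    would violate the pointwise comparison at \<open>u = 0\<close>, so this point is
    removed.\<close>
  then have g: "(?g has_integral right_weight \<nu> t - left_weight \<nu> t) ({0..2} - {0})"
    by (rule has_integral_spike_set_eq[THEN iffD1, rotated -1])
       (auto intro: negligible_subset[of "{0}"])
  have "((\<lambda>u. (t + 1) powr (- \<nu>) * (2 - 2 * u)) has_integral
      ((t + 1) powr (- \<nu>) * ((\<lambda>u. 2 * u - u\<^sup>2) 2 - (\<lambda>u. 2 * u - u\<^sup>2) 0))) {0..2::real}"
    by (intro has_integral_mult_right fundamental_theorem_of_calculus)
       (auto intro!: derivative_eq_intros simp: has_real_derivative_iff_has_vector_derivative[symmetric])
  then have "((\<lambda>u. (t + 1) powr (- \<nu>) * (2 - 2 * u)) has_integral 0) {0..2}"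
    by simp
  then have 0: "((\<lambda>u. (t + 1) powr (- \<nu>) * (2 - 2 * u)) has_integral 0) ({0..2} - {0})"
    by (rule has_integral_spike_set_eq[THEN iffD1, rotated -1])
       (auto intro: negligible_subset[of "{0}"])
  have "0 \<le> right_weight \<nu> t - left_weight \<nu> t"
  proof (rule has_integral_le[OF 0 g])
    fix u :: real assume u: "u \<in> {0..2} - {0}"
    have *: "?g u = (t + u) powr (- \<nu>) * (2 - 2 * u)" by (simp add: algebra_simps)
    show "(t + 1) powr (- \<nu>) * (2 - 2 * u) \<le> ?g u"
    proof (cases "u \<le> 1")
      case True
      then show ?thesis unfolding * using u assms
        by (intro mult_right_mono powr_mono2') auto
    next
      case False
      then show ?thesis unfolding * using u assms
        by (intro mult_right_mono_neg powr_mono2') auto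
    qed
  qed
  then show ?thesis by simp
qed

section \<open>Power inequalities and monotonicity of the weights\<close>

lemma powr_le_affine:
  fixes \<nu> x :: real
  assumes "0 < \<nu>" "\<nu> < 1" "-1 < x"
  shows "(1 + x) powr \<nu> \<le> 1 + \<nu> * x"
  using Youngs_inequality_0[of \<nu> "1 - \<nu>" "1 + x" 1] assms by (simp add: algebra_simps)

text \<open>The lower bounds follow from the Bernoulli bound for the positive power and
  \<open>(1 + x) * (1 - x) \<le> 1\<close>. The upper bounds apply the Bernoulli bound to the
  reciprocals \<open>1 + r / (1 - r)\<close> and \<open>1 - r / (1 + r)\<close>; the factors 2 and
  2/3 come from \<open>r \<le> 1 / 2\<close>.\<close>

lemma powr_neg_bounds:
  fixes \<nu> r :: real
  assumes \<nu>: "0 < \<nu>" "\<nu> < 1" and r: "0 \<le> r" "r \<le> 1 / 2"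
  shows "1 + \<nu> * r \<le> (1 - r) powr (- \<nu>)" "(1 - r) powr (- \<nu>) \<le> 1 + 2 * \<nu> * r"
    "1 - \<nu> * r \<le> (1 + r) powr (- \<nu>)" "(1 + r) powr (- \<nu>) \<le> 1 - 2 / 3 * \<nu> * r"
proof -
  have \<nu>r: "0 \<le> \<nu> * r" "\<nu> * r < 1"
    using \<nu> r mult_strict_mono'[of \<nu> 1 r 1] by auto
  have "(1 + \<nu> * r) * (1 - r) powr \<nu> \<le> (1 + \<nu> * r) * (1 - \<nu> * r)"
    using powr_le_affine[OF \<nu>, of "-r"] r \<nu>r by (intro mult_left_mono) auto
  also have "\<dots> = 1 - (\<nu> * r)\<^sup>2" by (simp add: algebra_simps power2_eq_square)
  also have "\<dots> \<le> 1" by simp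
  finally show "1 + \<nu> * r \<le> (1 - r) powr (- \<nu>)"
    using r by (simp add: powr_minus divide_simps)
  have "(1 - \<nu> * r) * (1 + r) powr \<nu> \<le> (1 - \<nu> * r) * (1 + \<nu> * r)"
    using powr_le_affine[OF \<nu>, of "r"] r \<nu>r by (intro mult_left_mono) auto
  also have "\<dots> = 1 - (\<nu> * r)\<^sup>2" by (simp add: algebra_simps power2_eq_square)
  also have "\<dots> \<le> 1" by simp
  finally show "1 - \<nu> * r \<le> (1 + r) powr (- \<nu>)"
    using r by (simp add: powr_minus divide_simps)
  have "1 + r / (1 - r) = inverse (1 - r)" using r by (simp add: field_simps)
  then have "(1 - r) powr (- \<nu>) = (1 + r / (1 - r)) powr \<nu>"
    using r by (simp only: powr_minus inverse_powr)
  also have "\<dots> \<le> 1 + \<nu> * (r / (1 - r))"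
    using r by (intro powr_le_affine \<nu>) (auto intro: less_le_trans[of _ 0])
  also have "r / (1 - r) \<le> 2 * r"
    using r mult_left_mono[of r "1/2" r] by (simp add: divide_simps algebra_simps)
  finally show "(1 - r) powr (- \<nu>) \<le> 1 + 2 * \<nu> * r"
    using \<nu> by (simp add: mult.assoc)
  have "1 + - (r / (1 + r)) = inverse (1 + r)" using r by (simp add: field_simps)
  then have "(1 + r) powr (- \<nu>) = (1 + - (r / (1 + r))) powr \<nu>"
    using r by (simp only: powr_minus inverse_powr)
  also have "\<dots> \<le> 1 + \<nu> * (- (r / (1 + r)))"
    using r by (intro powr_le_affine \<nu>) (auto simp: divide_simps)
  also have "\<nu> * (- (r / (1 + r))) \<le> \<nu> * (- (2 / 3 * r))"
    using r \<nu> mult_left_mono[of r "1/2" r] by (intro mult_left_mono) (auto simp: divide_simps algebra_simps)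
  finally show "(1 + r) powr (- \<nu>) \<le> 1 - 2 / 3 * \<nu> * r"
    by (simp add: mult.assoc)
qed

lemma powr_diff_bounds:
  fixes \<nu> c w :: real
  assumes \<nu>: "0 < \<nu>" "\<nu> < 1" and c: "4 \<le> c" and w: "0 \<le> w" "w \<le> 2"
  shows "5 / 3 * (\<nu> * c powr (- \<nu>) / c) * w \<le> (c - w) powr (- \<nu>) - (c + w) powr (- \<nu>)"
    "(c - w) powr (- \<nu>) - (c + w) powr (- \<nu>) \<le> 3 * (\<nu> * c powr (- \<nu>) / c) * w"
proof -
  define r where "r = w / c"
  have r: "0 \<le> r" "r \<le> 1 / 2" using c w by (auto simp: r_def field_simps)
  have cw: "c - w = c * (1 - r)" "c + w = c * (1 + r)" using c by (auto simp: r_def field_simps)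
  have *: "(c - w) powr (- \<nu>) - (c + w) powr (- \<nu>) = c powr (- \<nu>) * ((1 - r) powr (- \<nu>) - (1 + r) powr (- \<nu>))"
    unfolding cw using c r by (subst (1 2) powr_mult) (auto simp: right_diff_distrib)
  note b = powr_neg_bounds[OF \<nu> r]
  have "c powr (- \<nu>) * (5 / 3 * \<nu> * r) \<le> c powr (- \<nu>) * ((1 - r) powr (- \<nu>) - (1 + r) powr (- \<nu>))"
    using b by (intro mult_left_mono) auto
  then show "5 / 3 * (\<nu> * c powr (- \<nu>) / c) * w \<le> (c - w) powr (- \<nu>) - (c + w) powr (- \<nu>)"
    unfolding * by (simp add: r_def mult_ac)
  have "c powr (- \<nu>) * ((1 - r) powr (- \<nu>) - (1 + r) powr (- \<nu>)) \<le> c powr (- \<nu>) * (3 * \<nu> * r)"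
    using b by (intro mult_left_mono) auto
  then show "(c - w) powr (- \<nu>) - (c + w) powr (- \<nu>) \<le> 3 * (\<nu> * c powr (- \<nu>) / c) * w"
    unfolding * by (simp add: r_def mult_ac)
qed

text \<open>Reflecting the left cell weight about the node between the two blocks turns the
  difference into the integral of \<open>D w * (3 / 2 - w)\<close>. If \<open>D\<close> were linear
  this would be positive, since \<open>w * (3 / 2 - w)\<close> has integral 1/3 over
  \<open>{0..2}\<close>. The hypothesis \<open>2 \<le> t\<close> keeps \<open>w / (t + 2)\<close>
  below 1/2, which makes \<open>D\<close> close enough to linear.\<close>

lemma right_weight_le_left_weight:
  assumes \<nu>: "0 < \<nu>" "\<nu> < 1" and t: "2 \<le> t"
  shows "right_weight \<nu> (t + 2) \<le> left_weight \<nu> t"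
proof -
  define D where "D = (\<lambda>w. (t + 2 - w) powr (- \<nu>) - (t + 2 + w) powr (- \<nu>))"
  define k where "k = \<nu> * (t + 2) powr (- \<nu>) / (t + 2)"
  have k: "k \<ge> 0" using \<nu> t by (simp add: k_def)
  have "((\<lambda>w. (t + (2 - w)) powr (- \<nu>) * ((2 - w) - 1 / 2)) has_integral left_weight \<nu> t) {0..2}"
    using has_integral_affinity[of "\<lambda>u. (t + u) powr (- \<nu>) * (u - 1 / 2)" "left_weight \<nu> t" 0 2 "-1" 2]
      has_integral_left_weight[of \<nu> t] \<nu> t by (simp add: image_affinity_atLeastAtMost)
  from has_integral_diff[OF this has_integral_right_weight[of \<nu> "t + 2"]]
  have I: "((\<lambda>w. D w * (3 / 2 - w)) has_integral left_weight \<nu> t - right_weight \<nu> (t + 2)) {0..2}"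
    using \<nu> t by (simp add: D_def algebra_simps)
  \<comment> \<open>On \<open>w \<le> 3/2\<close> use the lower bound of \<open>D\<close>, beyond it the upper one; \<open>w^4/32\<close> majorises the positive
    part of \<open>w - 3/2\<close>.\<close>
  let ?P = "\<lambda>w::real. k * (5 / 3 * w * (3 / 2 - w) - 4 / 3 * w * (w ^ 4 / 32))"
  let ?Q = "\<lambda>w::real. k * (5 / 4 * w\<^sup>2 - 5 / 9 * w ^ 3 - w ^ 6 / 144)"
  have J: "(?P has_integral (?Q 2 - ?Q 0)) {0..2}"
    by (intro fundamental_theorem_of_calculus)
       (auto intro!: derivative_eq_intros simp: has_real_derivative_iff_has_vector_derivative[symmetric] field_simps power2_eq_square eval_nat_numeral)
  have "?Q 2 - ?Q 0 \<le> left_weight \<nu> t - right_weight \<nu> (t + 2)"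
  proof (rule has_integral_le[OF J I])
    fix w :: real assume "w \<in> {0..2}"
    then have w: "0 \<le> w" "w \<le> 2" by auto
    have D: "5 / 3 * k * w \<le> D w" "D w \<le> 3 * k * w"
      using powr_diff_bounds[OF \<nu> _ w, of "t + 2"] t by (simp_all add: D_def k_def)
    have kw: "0 \<le> k * w" using k w by simp
    \<comment> \<open>This product is \<open>w ^ 4 - 32 * w + 48\<close>: the quartic touches the
      line \<open>w - 3 / 2\<close> at the endpoint \<open>w = 2\<close>, where the loss matters
      most.\<close>
    have "0 \<le> (w - 2)\<^sup>2 * ((w + 2)\<^sup>2 + 8)" by simp
    then have p: "w - 3 / 2 \<le> w ^ 4 / 32" by (simp add: power2_eq_square algebra_simps eval_nat_numeral)
    show "?P w \<le> D w * (3 / 2 - w)"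
    proof (cases "w \<le> 3 / 2")
      case True
      have "?P w \<le> 5 / 3 * k * w * (3 / 2 - w)"
        using mult_nonneg_nonneg[OF kw, of "w ^ 4"] by (simp add: field_simps)
      also have "\<dots> \<le> D w * (3 / 2 - w)" using D True by (intro mult_right_mono) auto
      finally show ?thesis .
    next
      case False
      have "(k * w) * (w - 3 / 2) \<le> (k * w) * (w ^ 4 / 32)" using p kw by (intro mult_left_mono)
      then have "?P w \<le> 3 * k * w * (3 / 2 - w)" by (simp add: field_simps)
      also have "\<dots> \<le> D w * (3 / 2 - w)" using D False by (intro mult_right_mono_neg) auto
      finally show ?thesis .
    qed
  qed
  \<comment> \<open>The value is \<open>k / 9\<close>, so the crude constants 5/3 and 3 still leave
    a margin.\<close>
  moreover have "?Q 2 - ?Q 0 \<ge> 0" using k by simp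
  ultimately show ?thesis by simp
qed

text \<open>This is the comparison of the third damped weight with the second one, after division by
  the common factor; the right-hand side equals
  \<open>12 - 4 * \<nu> - damping \<nu> * (2 - \<nu>)\<close>, with \<open>damping\<close> as
  introduced below.\<close>

lemma two_powr_neg_le:
  fixes \<nu> :: real
  assumes \<nu>: "0 < \<nu>" "\<nu> < 1"
  shows "(12 + 2 * \<nu>) * 2 powr (- \<nu>) \<le> 12 - 6 * \<nu> + 4 * \<nu>\<^sup>2 / (2 + \<nu>)"
proof -
  define E where "E = (1 + \<nu> / 3 + \<nu>\<^sup>2 / 18)\<^sup>2"
  have "1 + \<nu> / 3 + (\<nu> / 3)\<^sup>2 / 2 \<le> exp (\<nu> / 3)"
    using \<nu> by (intro exp_lower_Taylor_quadratic) simp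
  then have "E \<le> (exp (\<nu> / 3))\<^sup>2"
    unfolding E_def using \<nu> by (intro power_mono) (auto simp: power_divide)
  also have "\<dots> = exp (\<nu> * (2 / 3))" by (simp add: power2_eq_square exp_add[symmetric])
  also have "\<dots> \<le> exp (\<nu> * ln 2)" using ln2_ge_two_thirds \<nu> by simp
  finally have E: "E \<le> 2 powr \<nu>" by (simp add: powr_def)
  \<comment> \<open>With 2/3 in place of \<open>ln 2\<close> the terms up to first order in
    \<open>\<nu>\<close> agree on both sides. The square of a quadratic Taylor polynomial is
    therefore used for the exponential, and the remaining difference has the factor
    \<open>\<nu>\<^sup>2\<close>.\<close>
  have "0 \<le> \<nu>\<^sup>2 * (432 - 144 * \<nu> - 120 * \<nu>\<^sup>2 - 24 * \<nu> ^ 3 - 2 * \<nu> ^ 4)"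
  proof (intro mult_nonneg_nonneg)
    have "\<nu>\<^sup>2 \<le> 1" "\<nu> ^ 3 \<le> 1" "\<nu> ^ 4 \<le> 1"
      using \<nu> by (auto intro: power_le_one)
    then show "0 \<le> 432 - 144 * \<nu> - 120 * \<nu>\<^sup>2 - 24 * \<nu> ^ 3 - 2 * \<nu> ^ 4"
      using \<nu> by simp
  qed simp
  then have "(12 + 2 * \<nu>) * (2 + \<nu>) \<le> (24 - 2 * \<nu>\<^sup>2) * E"
    unfolding E_def by (simp add: field_simps power2_eq_square eval_nat_numeral)
  also have "24 - 2 * \<nu>\<^sup>2 = (12 - 6 * \<nu> + 4 * \<nu>\<^sup>2 / (2 + \<nu>)) * (2 + \<nu>)"
    using \<nu> by (simp add: field_simps power2_eq_square)
  finally have *: "12 + 2 * \<nu> \<le> (12 - 6 * \<nu> + 4 * \<nu>\<^sup>2 / (2 + \<nu>)) * E"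
    using \<nu> by simp
  also have "\<dots> \<le> (12 - 6 * \<nu> + 4 * \<nu>\<^sup>2 / (2 + \<nu>)) * 2 powr \<nu>"
    using \<nu> E by (intro mult_left_mono) (auto intro: add_nonneg_nonneg)
  finally show ?thesis by (simp add: powr_minus divide_simps)
qed

section \<open>Discrete convolutions\<close>

definition conv_diff :: "(nat \<Rightarrow> real) \<Rightarrow> (nat \<Rightarrow> real) \<Rightarrow> nat \<Rightarrow> real" where
  "conv_diff \<phi> w j = (\<Sum>k<j. \<phi> k * (w (j - k) - w (j - Suc k)))"

text \<open>Summation by parts: for decreasing weights the past values enter with coefficients of a
  single sign, which is what the comparison principle needs.\<close>

lemma conv_diff_Suc:
  "conv_diff \<phi> w (Suc n) =
     \<phi> 0 * w (Suc n) - (\<Sum>k<n. (\<phi> k - \<phi> (Suc k)) * w (n - k)) - \<phi> n * w 0"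
proof -
  have "conv_diff \<phi> w (Suc n) =
      (\<Sum>k<Suc n. \<phi> k * w (Suc n - k)) - (\<Sum>k<Suc n. \<phi> k * w (n - k))"
    by (simp add: conv_diff_def right_diff_distrib sum_subtractf del: sum.lessThan_Suc)
  also have "(\<Sum>k<Suc n. \<phi> k * w (Suc n - k)) = \<phi> 0 * w (Suc n) + (\<Sum>k<n. \<phi> (Suc k) * w (n - k))"
    by (subst sum.lessThan_Suc_shift) simp
  also have "(\<Sum>k<Suc n. \<phi> k * w (n - k)) = (\<Sum>k<n. \<phi> k * w (n - k)) + \<phi> n * w 0"
    by simp
  finally show ?thesis by (simp add: left_diff_distrib sum_subtractf)
qed

text \<open>The bounds for \<open>w\<close> and \<open>e\<close> are carried through one induction,
  because the right-hand side of the equation for \<open>w\<close> contains \<open>e\<close>. The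
  term \<open>\<phi> (j - 1) * v 0\<close> in \<open>super\<close> makes up for \<open>v\<close>
  being positive at 0, where \<open>w\<close> vanishes. The implicit part
  \<open>a * \<bar>w j\<bar>\<close> is absorbed by \<open>a < \<phi> 0\<close>.\<close>

lemma conv_diff_comparison:
  fixes \<phi> e w v :: "nat \<Rightarrow> real" and a \<eta> \<epsilon> F K :: real
  assumes dec: "\<And>k. \<phi> (Suc k) \<le> \<phi> k"
    and \<eta>: "0 \<le> \<eta>" "\<eta> < 1"
    and e0: "e 0 = 0" and w0: "w 0 = 0" and w: "\<And>i. w (Suc i) = e (Suc i) - \<eta> * e i"
    and v: "mono v" "v 0 \<ge> 1" and a: "0 \<le> a" "a < \<phi> 0" and K: "0 \<le> K"
    and eq: "\<And>j. 1 \<le> j \<Longrightarrow> j \<le> J \<Longrightarrow> \<bar>conv_diff \<phi> w j\<bar> \<le> a * \<bar>e j\<bar> + F"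
    and super: "\<And>j. 1 \<le> j \<Longrightarrow> (a / (1 - \<eta>) + \<epsilon>) * v j \<le> conv_diff \<phi> v j + \<phi> (j - 1) * v 0"
    and F: "0 \<le> \<epsilon>" "F \<le> K * \<epsilon>"
  shows "j \<le> J \<Longrightarrow> \<bar>w j\<bar> \<le> K * v j \<and> \<bar>e j\<bar> \<le> K * v j / (1 - \<eta>)"
proof (induction j rule: less_induct)
  case (less j)
  have v1: "1 \<le> v i" for i using v monoD[OF v(1), of 0 i] by simp
  have v0: "0 \<le> v i" for i using v1[of i] by simp
  show ?case
  proof (cases j)
    case 0
    then show ?thesis using e0 w0 K v0 \<eta> by simp
  next
    case (Suc n)
    have IH: "\<bar>w i\<bar> \<le> K * v i" "\<bar>e i\<bar> \<le> K * v i / (1 - \<eta>)" if "i \<le> n" for i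
      using less that Suc by auto
    have S: "\<bar>\<Sum>k<n. (\<phi> k - \<phi> (Suc k)) * w (n - k)\<bar> \<le> K * (\<Sum>k<n. (\<phi> k - \<phi> (Suc k)) * v (n - k))"
    proof -
      have "\<bar>\<Sum>k<n. (\<phi> k - \<phi> (Suc k)) * w (n - k)\<bar> \<le> (\<Sum>k<n. (\<phi> k - \<phi> (Suc k)) * (K * v (n - k)))"
        by (rule order_trans[OF sum_abs], rule sum_mono)
           (use dec IH in \<open>auto simp: abs_mult intro!: mult_mono\<close>)
      also have "\<dots> = K * (\<Sum>k<n. (\<phi> k - \<phi> (Suc k)) * v (n - k))"
        by (simp add: sum_distrib_left mult_ac)
      finally show ?thesis .
    qed
    have "\<bar>e n\<bar> \<le> K * v j / (1 - \<eta>)"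
    proof -
      have "K * v n / (1 - \<eta>) \<le> K * v j / (1 - \<eta>)"
        using K v Suc \<eta> by (intro divide_right_mono mult_left_mono) (auto intro: monoD)
      then show ?thesis using IH(2)[of n] by simp
    qed
    then have en: "\<eta> * \<bar>e n\<bar> \<le> \<eta> * (K * v j / (1 - \<eta>))"
      using \<eta> by (intro mult_left_mono) auto
    have ej: "\<bar>e j\<bar> \<le> \<bar>w j\<bar> + \<eta> * (K * v j / (1 - \<eta>))"
    proof -
      have "e j = w j + \<eta> * e n" using w[of n] Suc by simp
      then have "\<bar>e j\<bar> \<le> \<bar>w j\<bar> + \<eta> * \<bar>e n\<bar>"
        using abs_triangle_ineq[of "w j" "\<eta> * e n"] \<eta> by (simp add: abs_mult)
      then show ?thesis using en by simp
    qed
    have "\<phi> 0 * w j = conv_diff \<phi> w j + (\<Sum>k<n. (\<phi> k - \<phi> (Suc k)) * w (n - k))"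
      using conv_diff_Suc[of \<phi> w n] w0 Suc by simp
    then have "\<phi> 0 * \<bar>w j\<bar> \<le> \<bar>conv_diff \<phi> w j\<bar> + \<bar>\<Sum>k<n. (\<phi> k - \<phi> (Suc k)) * w (n - k)\<bar>"
      using abs_triangle_ineq[of "conv_diff \<phi> w j" "\<Sum>k<n. (\<phi> k - \<phi> (Suc k)) * w (n - k)"] a
        abs_mult[of "\<phi> 0" "w j"] by simp
    also have "\<dots> \<le> (a * \<bar>e j\<bar> + F) + K * (\<Sum>k<n. (\<phi> k - \<phi> (Suc k)) * v (n - k))"
      using S eq[of j] less.prems Suc by simp
    also have "(\<Sum>k<n. (\<phi> k - \<phi> (Suc k)) * v (n - k)) = \<phi> 0 * v j - (conv_diff \<phi> v j + \<phi> (j - 1) * v 0)"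
      using conv_diff_Suc[of \<phi> v n] Suc by simp
    also have "K * \<dots> \<le> K * (\<phi> 0 * v j - (a / (1 - \<eta>) + \<epsilon>) * v j)"
      using super[of j] Suc K by (intro mult_left_mono) auto
    also have "a * \<bar>e j\<bar> \<le> a * (\<bar>w j\<bar> + \<eta> * (K * v j / (1 - \<eta>)))"
      using ej a by (intro mult_left_mono)
    also have "F \<le> K * \<epsilon> * v j"
      using F K v1[of j] mult_left_mono[of 1 "v j" "K * \<epsilon>"] by simp
    finally have "\<phi> 0 * \<bar>w j\<bar> \<le> a * (\<bar>w j\<bar> + \<eta> * (K * v j / (1 - \<eta>))) + K * \<epsilon> * v j
        + K * (\<phi> 0 * v j - (a / (1 - \<eta>) + \<epsilon>) * v j)"
      by simp
    also have "\<dots> = a * \<bar>w j\<bar> + (\<phi> 0 - a) * (K * v j)"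
    proof -
      \<comment> \<open>\<open>x\<close> is the fixed point of
        \<open>x = K * v j + \<eta> * x\<close>, hence the bound for \<open>e\<close> that survives
        the recursion. Its contribution \<open>a * x\<close> is exactly what the summand
        \<open>a / (1 - \<eta>)\<close> in \<open>super\<close> cancels.\<close>
      define x where "x = K * v j / (1 - \<eta>)"
      have Kv: "K * v j = (1 - \<eta>) * x" using \<eta> by (simp add: x_def)
      have "K * (\<phi> 0 * v j - (a / (1 - \<eta>) + \<epsilon>) * v j) = \<phi> 0 * (K * v j) - a * x - K * \<epsilon> * v j"
        by (simp add: x_def algebra_simps)
      moreover have "a * (\<bar>w j\<bar> + \<eta> * x) - a * x = a * \<bar>w j\<bar> - a * (K * v j)"
        unfolding Kv by (simp add: algebra_simps)
      ultimately show ?thesis unfolding x_def[symmetric] left_diff_distrib by linarith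
    qed
    finally have "(\<phi> 0 - a) * \<bar>w j\<bar> \<le> (\<phi> 0 - a) * (K * v j)"
      by (simp add: algebra_simps)
    then have wj: "\<bar>w j\<bar> \<le> K * v j" using a by simp
    have "\<bar>e j\<bar> \<le> K * v j + \<eta> * (K * v j / (1 - \<eta>))" using ej wj by simp
    also have "\<dots> = K * v j / (1 - \<eta>)" using \<eta> by (simp add: field_simps)
    finally show ?thesis using wj by simp
  qed
qed

text \<open>Only the lags below \<open>M\<close> are kept, where the weights are at least
  \<open>\<phi> (M - 1)\<close> and the increments of \<open>v\<close> telescope. If
  \<open>j > M\<close>, going back \<open>M\<close> steps at least halves \<open>v\<close>, since
  \<open>exp (s * M) \<ge> 1 + s * M \<ge> 2\<close>. If \<open>j \<le> M\<close>, the telescoped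
  sum misses \<open>v 0\<close>, and the added term \<open>\<phi> (j - 1) * v 0\<close> supplies
  it.\<close>

lemma conv_diff_exp:
  fixes \<phi> :: "nat \<Rightarrow> real"
  assumes dec: "\<And>k. \<phi> (Suc k) \<le> \<phi> k" and pos: "\<And>k. 0 \<le> \<phi> k"
    and s: "0 \<le> s" and M: "1 \<le> M" "1 \<le> s * real M" and j: "1 \<le> j"
  defines "v \<equiv> (\<lambda>n. exp (s * real n))"
  shows "\<phi> (M - 1) / 2 * v j \<le> conv_diff \<phi> v j + \<phi> (j - 1) * v 0"
proof -
  have mono: "v a \<le> v b" if "a \<le> b" for a b
    using that s by (simp add: v_def mult_left_mono)
  have \<phi>: "\<phi> b \<le> \<phi> a" if "a \<le> b" for a b
    using that dec by (metis lift_Suc_antimono_le)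
  have part: "\<phi> (M - 1) * (v j - v (j - m)) \<le> conv_diff \<phi> v j" if m: "m \<le> M" "m \<le> j" for m
  proof -
    have "(\<Sum>k<m. v (j - k) - v (j - Suc k)) = v j - v (j - m)"
      using sum_lessThan_telescope'[of "\<lambda>k. v (j - k)" m] by simp
    then have "\<phi> (M - 1) * (v j - v (j - m)) = (\<Sum>k<m. \<phi> (M - 1) * (v (j - k) - v (j - Suc k)))"
      by (metis sum_distrib_left)
    also have "\<dots> \<le> (\<Sum>k<m. \<phi> k * (v (j - k) - v (j - Suc k)))"
      using m by (intro sum_mono mult_right_mono \<phi>) (auto intro: mono)
    also have "\<dots> \<le> conv_diff \<phi> v j"
      unfolding conv_diff_def using m pos mono by (intro sum_mono2) auto
    finally show ?thesis .
  qed
  show ?thesis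
  proof (cases "j \<le> M")
    case True
    have "\<phi> (M - 1) / 2 * v j \<le> \<phi> (M - 1) * v j"
      using pos by (intro mult_right_mono) (auto simp: v_def)
    also have "\<dots> = \<phi> (M - 1) * (v j - v (j - j)) + \<phi> (M - 1) * v 0"
      by (simp add: algebra_simps)
    also have "\<dots> \<le> conv_diff \<phi> v j + \<phi> (j - 1) * v 0"
      using part[of j] True \<phi>[of "j - 1" "M - 1"] by (intro add_mono mult_right_mono) (auto simp: v_def)
    finally show ?thesis .
  next
    case False
    have "2 \<le> exp (s * real M)"
      using exp_ge_add_one_self[of "s * real M"] M by linarith
    then have "2 * v (j - M) \<le> exp (s * real M) * v (j - M)"
      by (intro mult_right_mono) (auto simp: v_def)
    also have "\<dots> = v j"
      using False by (simp add: v_def exp_add[symmetric] of_nat_diff algebra_simps)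
    finally have "v j / 2 \<le> v j - v (j - M)" by simp
    then have "\<phi> (M - 1) * (v j / 2) \<le> \<phi> (M - 1) * (v j - v (j - M))"
      using pos by (intro mult_left_mono)
    then have "\<phi> (M - 1) / 2 * v j \<le> conv_diff \<phi> v j"
      using part[of M] False by simp
    moreover have "0 \<le> \<phi> (j - 1) * v 0" using pos by (simp add: v_def)
    ultimately show ?thesis by simp
  qed
qed

text \<open>In generating functions, \<open>\<theta>\<close> is \<open>1 - \<eta> * x\<close> times
  \<open>\<phi>\<close> and \<open>w\<close> is \<open>1 - \<eta> * x\<close> times
  \<open>e\<close>; the factor merely moves from the weights to the grid function.\<close>

lemma conv_diff_quotient:
  fixes \<theta> \<phi> e w :: "nat \<Rightarrow> real"
  assumes \<phi>: "\<phi> 0 = \<theta> 0" "\<And>k. \<phi> (Suc k) = \<theta> (Suc k) + \<eta> * \<phi> k"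
    and e: "e 0 = 0" and w: "w 0 = 0" "\<And>i. w (Suc i) = e (Suc i) - \<eta> * e i"
  shows "conv_diff \<theta> e j = conv_diff \<phi> w j"
proof (cases j)
  case (Suc n)
  have "conv_diff \<theta> e j = \<phi> 0 * (e j - e n) + (\<Sum>k<n. (\<phi> (Suc k) - \<eta> * \<phi> k) * (e (n - k) - e (n - Suc k)))"
    unfolding conv_diff_def Suc by (subst sum.lessThan_Suc_shift) (simp add: \<phi>)
  also have "\<dots> = (\<phi> 0 * (e j - e n) + (\<Sum>k<n. \<phi> (Suc k) * (e (n - k) - e (n - Suc k))))
      - (\<Sum>k<n. \<phi> k * (\<eta> * (e (n - k) - e (n - Suc k))))"
    by (simp add: sum_subtractf left_diff_distrib mult_ac)
  also have "\<phi> 0 * (e j - e n) + (\<Sum>k<n. \<phi> (Suc k) * (e (n - k) - e (n - Suc k)))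
      = (\<Sum>k<Suc n. \<phi> k * (e (Suc n - k) - e (n - k)))"
    unfolding Suc by (subst sum.lessThan_Suc_shift) simp
  also have "\<dots> - (\<Sum>k<n. \<phi> k * (\<eta> * (e (n - k) - e (n - Suc k))))
     = (\<Sum>k<n. \<phi> k * (w (j - k) - w (j - Suc k))) + \<phi> n * (w (j - n) - w (j - Suc n))"
  proof -
    have "w (j - k) - w (j - Suc k) = (e (Suc n - k) - e (n - k)) - \<eta> * (e (n - k) - e (n - Suc k))"
      if "k < n" for k
    proof -
      from that obtain i where i: "n - k = Suc i" by (metis Suc_diff_Suc)
      then have "Suc n - k = Suc (Suc i)" "n - Suc k = i" using that by auto
      then show ?thesis using i Suc by (simp add: w algebra_simps)
    qed
    then have "(\<Sum>k<n. \<phi> k * (w (j - k) - w (j - Suc k))) =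
       (\<Sum>k<n. \<phi> k * (e (Suc n - k) - e (n - k)) - \<phi> k * (\<eta> * (e (n - k) - e (n - Suc k))))"
      by (intro sum.cong refl) (simp only: lessThan_iff right_diff_distrib)
    then have "(\<Sum>k<n. \<phi> k * (w (j - k) - w (j - Suc k))) =
       (\<Sum>k<n. \<phi> k * (e (Suc n - k) - e (n - k))) - (\<Sum>k<n. \<phi> k * (\<eta> * (e (n - k) - e (n - Suc k))))"
      by (simp only: sum_subtractf)
    then show ?thesis using Suc e w by simp
  qed
  also have "\<dots> = conv_diff \<phi> w j" by (simp add: conv_diff_def Suc)
  finally show ?thesis .
qed (simp add: conv_diff_def)

section \<open>The damped weights\<close>

text \<open>Both cells of a block share the distance of its right end from the evaluation point. A
  cell at odd lag \<open>k\<close> is the left one, and the right cell of its block has lag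
  \<open>k - 1\<close>.\<close>

definition step_weight :: "real \<Rightarrow> nat \<Rightarrow> real" where
  "step_weight \<nu> k = (if even k then right_weight \<nu> (real k) else left_weight \<nu> (real (k - 1)))"

definition damping :: "real \<Rightarrow> real" where
  "damping \<nu> = 2 * \<nu> / (2 + \<nu>)"

primrec quotient_weight :: "real \<Rightarrow> nat \<Rightarrow> real" where
  "quotient_weight \<nu> 0 = step_weight \<nu> 0"
| "quotient_weight \<nu> (Suc k) = step_weight \<nu> (Suc k) + damping \<nu> * quotient_weight \<nu> k"

lemma damping_bounds:
  assumes "0 < \<nu>" "\<nu> < 1"
  shows "0 \<le> damping \<nu>" "damping \<nu> < 1" "1 / (1 - damping \<nu>) \<le> 3"
  using assms by (simp_all add: damping_def field_simps)

lemma step_weight_Suc_le: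
  assumes \<nu>: "0 < \<nu>" "\<nu> < 1" and k: "2 \<le> k"
  shows "step_weight \<nu> (Suc k) \<le> step_weight \<nu> k"
proof (cases "even k")
  case True
  then show ?thesis using left_weight_le_right_weight[OF \<nu>, of "real k"] by (simp add: step_weight_def)
next
  case False
  with k have "k \<ge> 3" by (cases "k = 2") auto
  then have "2 \<le> real (k - 1)" "real (Suc k) = real (k - 1) + 2" by auto
  then show ?thesis using right_weight_le_left_weight[OF \<nu>, of "real (k - 1)"] False by (simp add: step_weight_def)
qed

text \<open>The two weights of a block add up to the integral of the plain power, and the larger one
  is at least half of it. An odd \<open>k\<close> borrows the bound of \<open>k + 1\<close>, which
  turns \<open>k + 2\<close> into \<open>k + 3\<close>.\<close>

lemma step_weight_ge:
  assumes \<nu>: "0 < \<nu>" "\<nu> < 1" and k: "2 \<le> k"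
  shows "real (k + 3) powr (- \<nu>) \<le> step_weight \<nu> k"
proof -
  have even: "real (k + 2) powr (- \<nu>) \<le> step_weight \<nu> k" if k: "2 \<le> k" "even k" for k
  proof -
    have s: "((\<lambda>u. (real k + u) powr (- \<nu>) * (3 / 2 - u) + (real k + u) powr (- \<nu>) * (u - 1 / 2))
        has_integral right_weight \<nu> (real k) + left_weight \<nu> (real k)) {0..2}"
      using \<nu> by (intro has_integral_add has_integral_right_weight has_integral_left_weight) auto
    have c: "((\<lambda>u. real (k + 2) powr (- \<nu>)) has_integral 2 * real (k + 2) powr (- \<nu>)) {0..2::real}"
      using has_integral_const_real[of "real (k + 2) powr (- \<nu>)" 0 2] by simp
    have le: "real (k + 2) powr (- \<nu>) \<le>
        (real k + u) powr (- \<nu>) * (3 / 2 - u) + (real k + u) powr (- \<nu>) * (u - 1 / 2)"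
      if "u \<in> {0..2}" for u :: real
    proof -
      have "real (k + 2) powr (- \<nu>) \<le> (real k + u) powr (- \<nu>)"
        using that \<nu> k by (intro powr_mono2') auto
      then show ?thesis by (simp add: algebra_simps)
    qed
    have "2 * real (k + 2) powr (- \<nu>) \<le> right_weight \<nu> (real k) + left_weight \<nu> (real k)"
      using has_integral_le[OF c s le] .
    then have "2 * real (k + 2) powr (- \<nu>) \<le> step_weight \<nu> k + step_weight \<nu> (Suc k)"
      using k by (simp add: step_weight_def)
    then show ?thesis using step_weight_Suc_le[OF \<nu> k(1)] by simp
  qed
  show ?thesis
  proof (cases "even k")
    case True
    have "real (k + 3) powr (- \<nu>) \<le> real (k + 2) powr (- \<nu>)"
      using \<nu> by (intro powr_mono2') auto
    then show ?thesis using even[OF k True] by simp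
  next
    case False
    then have "real (Suc k + 2) powr (- \<nu>) \<le> step_weight \<nu> (Suc k)" using k by (intro even) auto
    then show ?thesis using step_weight_Suc_le[OF \<nu> k] by (simp add: add.commute)
  qed
qed

lemma quotient_weight_1:
  assumes \<nu>: "0 < \<nu>" "\<nu> < 1"
  shows "quotient_weight \<nu> 1 = 2 powr (1 - \<nu>) / (2 * (1 - \<nu>) * (2 - \<nu>)) * (2 - \<nu>)"
proof -
  define c where "c = 2 powr (1 - \<nu>) / (2 * (1 - \<nu>) * (2 - \<nu>))"
  have "quotient_weight \<nu> 1 = step_weight \<nu> 1 + damping \<nu> * step_weight \<nu> 0" by simp
  also have "\<dots> = c * (2 - 3 * \<nu>) + damping \<nu> * (c * (2 + \<nu>))"
    using right_weight_0[OF \<nu>] left_weight_0[OF \<nu>] by (simp add: step_weight_def c_def)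
  also have "\<dots> = c * (2 - \<nu>)" using \<nu> by (simp add: damping_def field_simps)
  finally show ?thesis by (simp add: c_def)
qed

text \<open>The first two comparisons use the explicit values of the weights. Afterwards both
  summands of the recursion decrease, one by \<open>step_weight_Suc_le\<close> and the other by
  induction.\<close>

lemma quotient_weight_Suc_le:
  assumes \<nu>: "0 < \<nu>" "\<nu> < 1"
  shows "quotient_weight \<nu> (Suc k) \<le> quotient_weight \<nu> k"
proof (induction k rule: less_induct)
  case (less k)
  define c where "c = 2 powr (1 - \<nu>) / (2 * (1 - \<nu>) * (2 - \<nu>))"
  have c: "0 \<le> c" using \<nu> by (simp add: c_def)
  have \<theta>0: "step_weight \<nu> 0 = c * (2 + \<nu>)" using right_weight_0[OF \<nu>] by (simp add: step_weight_def c_def)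
  have \<theta>2: "step_weight \<nu> 2 = c * ((12 + 2 * \<nu>) * 2 powr (- \<nu>) - 10 + 3 * \<nu>)" using right_weight_2[OF \<nu>] by (simp add: step_weight_def c_def)
  have \<phi>1: "quotient_weight \<nu> 1 = c * (2 - \<nu>)"
    using quotient_weight_1[OF \<nu>] by (simp add: c_def)
  consider "k = 0" | "k = 1" | "k \<ge> 2" by linarith
  then show ?case
  proof cases
    case 1
    have "c * (2 - \<nu>) \<le> c * (2 + \<nu>)" using c \<nu> by (intro mult_left_mono) auto
    then show ?thesis using 1 \<phi>1 \<theta>0 by simp
  next
    case 2
    have "(12 + 2 * \<nu>) * 2 powr (- \<nu>) - 10 + 3 * \<nu> + damping \<nu> * (2 - \<nu>) \<le>
        12 - 6 * \<nu> + 4 * \<nu>\<^sup>2 / (2 + \<nu>) - 10 + 3 * \<nu> + damping \<nu> * (2 - \<nu>)"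
      using two_powr_neg_le[OF \<nu>] by simp
    also have "\<dots> = 2 - \<nu>"
    proof -
      have "4 * \<nu>\<^sup>2 + 2 * \<nu> * (2 - \<nu>) = 2 * \<nu> * (2 + \<nu>)"
        by (simp add: power2_eq_square algebra_simps)
      then have "4 * \<nu>\<^sup>2 / (2 + \<nu>) + damping \<nu> * (2 - \<nu>) = 2 * \<nu> * (2 + \<nu>) / (2 + \<nu>)"
        by (simp add: damping_def add_divide_distrib[symmetric])
      then show ?thesis using \<nu> by simp
    qed
    finally have "c * ((12 + 2 * \<nu>) * 2 powr (- \<nu>) - 10 + 3 * \<nu> + damping \<nu> * (2 - \<nu>)) \<le> c * (2 - \<nu>)"
      using c by (intro mult_left_mono)
    moreover have "quotient_weight \<nu> 2 = step_weight \<nu> 2 + damping \<nu> * quotient_weight \<nu> 1" by (simp add: numeral_2_eq_2)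
    ultimately have "quotient_weight \<nu> 2 \<le> quotient_weight \<nu> 1" unfolding \<phi>1 \<theta>2 by (simp add: algebra_simps)
    then show ?thesis using 2 by (simp add: numeral_2_eq_2)
  next
    case 3
    then obtain i where i: "k = Suc i" by (cases k) auto
    have "damping \<nu> * quotient_weight \<nu> k \<le> damping \<nu> * quotient_weight \<nu> i"
      using less[of i] i damping_bounds[OF \<nu>] by (intro mult_left_mono) auto
    then show ?thesis using step_weight_Suc_le[OF \<nu> 3] i by simp
  qed
qed

text \<open>The shift 5 is \<open>2 + 3\<close>: the bound with \<open>k + 3\<close> is available
  from \<open>k = 2\<close> on, and the two earlier weights inherit the value at 2 by
  monotonicity.\<close>

lemma quotient_weight_ge:
  assumes \<nu>: "0 < \<nu>" "\<nu> < 1"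
  shows "real (k + 5) powr (- \<nu>) \<le> quotient_weight \<nu> k"
proof -
  have pos: "0 \<le> quotient_weight \<nu> k" for k
  proof (induction k)
    case 0
    then show ?case using right_weight_0[OF \<nu>] \<nu> by (simp add: step_weight_def)
  next
    case (Suc k)
    show ?case
    proof (cases k)
      case 0
      have "0 \<le> quotient_weight \<nu> 1" unfolding quotient_weight_1[OF \<nu>] using \<nu> by simp
      then show ?thesis using 0 by simp
    next
      case (Suc i)
      have "0 \<le> step_weight \<nu> (Suc k)" using step_weight_ge[OF \<nu>, of "Suc k"] Suc by (auto intro: order_trans[rotated])
      then show ?thesis using Suc.IH damping_bounds[OF \<nu>] by simp
    qed
  qed
  have ge: "real (k + 3) powr (- \<nu>) \<le> quotient_weight \<nu> k" if k: "2 \<le> k" for k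
  proof -
    obtain i where "k = Suc i" using k by (cases k) auto
    then show ?thesis using step_weight_ge[OF \<nu> k] pos[of i] damping_bounds[OF \<nu>] by (simp add: add_increasing2)
  qed
  show ?thesis
  proof (cases "2 \<le> k")
    case True
    have "real (k + 5) powr (- \<nu>) \<le> real (k + 3) powr (- \<nu>)"
      using \<nu> by (intro powr_mono2') auto
    then show ?thesis using ge[OF True] by simp
  next
    case False
    have "quotient_weight \<nu> 2 \<le> quotient_weight \<nu> k"
      by (rule lift_Suc_antimono_le[of "quotient_weight \<nu>", OF quotient_weight_Suc_le[OF \<nu>]]) (use False in simp)
    moreover have "real (k + 5) powr (- \<nu>) \<le> real (2 + 3) powr (- \<nu>)"
      using \<nu> by (intro powr_mono2') auto
    ultimately show ?thesis using ge[of 2] by simp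
  qed
qed

section \<open>Bounds uniform in the distance, for the correction at odd steps\<close>

lemma abs_has_integral_powr_le:
  fixes \<nu> t d I B :: real
  assumes \<nu>: "0 < \<nu>" "\<nu> < 1" and t: "0 \<le> t" and d: "0 \<le> d"
    and I: "((\<lambda>u. (t + u) powr (- \<nu>) * f u) has_integral I) {0..d}"
    and f: "\<And>u. u \<in> {0..d} \<Longrightarrow> \<bar>f u\<bar> \<le> B"
  shows "\<bar>I\<bar> \<le> B * d powr (1 - \<nu>) / (1 - \<nu>)"
proof -
  have B: "0 \<le> B" using f[of 0] d by auto
  \<comment> \<open>The dominating function is the kernel with \<open>t = 0\<close>. Its value at
    \<open>u = 0\<close> is reset, because \<open>0 powr (- \<nu>) = 0\<close> would not dominate
    there.\<close>
  let ?g = "\<lambda>u. if u = 0 then t powr (- \<nu>) * B else u powr (- \<nu>) * B"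
  have "((\<lambda>u. u powr (- \<nu>) * B) has_integral B * d powr (1 - \<nu>) / (1 - \<nu>)) {0..d}"
    using has_integral_powr_affine[of \<nu> 0 0 d B 0] \<nu> d by simp
  then have g: "(?g has_integral B * d powr (1 - \<nu>) / (1 - \<nu>)) {0..d}"
    by (rule has_integral_spike_finite[rotated -1, of _ _ _ "{0}"]) auto
  have "norm (integral {0..d} (\<lambda>u. (t + u) powr (- \<nu>) * f u)) \<le> integral {0..d} ?g"
  proof (rule integral_norm_bound_integral)
    fix u assume u: "u \<in> {0..d}"
    have "norm ((t + u) powr (- \<nu>) * f u) \<le> (t + u) powr (- \<nu>) * B"
      using f[OF u] by (simp add: abs_mult mult_left_mono)
    also have "\<dots> \<le> ?g u"
      using u t B \<nu> by (auto intro!: mult_right_mono powr_mono2')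
    finally show "norm ((t + u) powr (- \<nu>) * f u) \<le> ?g u" .
  qed (use I g in \<open>auto intro: has_integral_integrable\<close>)
  then show ?thesis using I g by (simp add: integral_unique)
qed

text \<open>In units of \<open>1 / (1 - \<nu>)\<close> the two integrals contribute at most 3/2 and
  3, and 5 covers their sum.\<close>

lemma abs_first_weight_minus_right_weight_le:
  assumes \<nu>: "0 < \<nu>" "\<nu> < 1" and t: "0 \<le> t"
  shows "\<bar>first_weight \<nu> t p q - right_weight \<nu> t * p\<bar> \<le> 5 / (1 - \<nu>) * (\<bar>p\<bar> + \<bar>q\<bar>)"
proof -
  have "\<bar>first_weight \<nu> t p q\<bar> \<le> (3 / 2 * (\<bar>p\<bar> + \<bar>q\<bar>)) * 1 powr (1 - \<nu>) / (1 - \<nu>)"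
  proof (rule abs_has_integral_powr_le[OF \<nu> t _ has_integral_first_weight])
    fix u :: real assume u: "u \<in> {0..1}"
    have "\<bar>p * (u + 1 / 2) + q * (1 / 2 - u)\<bar> \<le> \<bar>p\<bar> * \<bar>u + 1 / 2\<bar> + \<bar>q\<bar> * \<bar>1 / 2 - u\<bar>"
      by (metis abs_mult abs_triangle_ineq)
    also have "\<dots> \<le> \<bar>p\<bar> * (3 / 2) + \<bar>q\<bar> * (3 / 2)"
      using u by (intro add_mono mult_left_mono) (auto simp: abs_if)
    finally show "\<bar>p * (u + 1 / 2) + q * (1 / 2 - u)\<bar> \<le> 3 / 2 * (\<bar>p\<bar> + \<bar>q\<bar>)" by simp
  qed (use \<nu> t in auto)
  moreover have "\<bar>right_weight \<nu> t\<bar> \<le> 3 / 2 * 2 powr (1 - \<nu>) / (1 - \<nu>)"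
    by (rule abs_has_integral_powr_le[OF \<nu> t _ has_integral_right_weight]) (use \<nu> t in \<open>auto simp: abs_if\<close>)
  moreover have "3 / 2 * 2 powr (1 - \<nu>) / (1 - \<nu>) \<le> 3 / 2 * 2 powr 1 / (1 - \<nu>)"
    using \<nu> by (intro divide_right_mono mult_left_mono powr_mono) auto
  moreover define r where "r = 1 / (1 - \<nu>)"
  ultimately have 1: "\<bar>first_weight \<nu> t p q\<bar> \<le> 3 / 2 * r * (\<bar>p\<bar> + \<bar>q\<bar>)" and 2: "\<bar>right_weight \<nu> t\<bar> \<le> 3 * r"
    by simp_all
  have "\<bar>right_weight \<nu> t * p\<bar> \<le> 3 * r * \<bar>p\<bar>"
    unfolding abs_mult using 2 by (rule mult_right_mono) simp
  moreover have "0 \<le> r * (\<bar>p\<bar> / 2 + 7 / 2 * \<bar>q\<bar>)"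
    using \<nu> by (intro mult_nonneg_nonneg) (auto simp: r_def)
  ultimately have "\<bar>first_weight \<nu> t p q - right_weight \<nu> t * p\<bar> \<le> 5 * r * (\<bar>p\<bar> + \<bar>q\<bar>)"
    using 1 abs_triangle_ineq4[of "first_weight \<nu> t p q" "right_weight \<nu> t * p"] by (simp add: algebra_simps)
  then show ?thesis by (simp add: r_def)
qed

section \<open>The discrete derivative as a convolution\<close>

lemma quad_interp_pderiv:
  assumes h: "h > 0"
  shows "poly (pderiv (quad_interp h z i)) s =
    ((z (i + 2) - z (i + 1)) * (s - grid h i - h / 2) + (z (i + 1) - z i) * (grid h i + 3 * h / 2 - s)) / h\<^sup>2"
proof -
  let ?a = "grid h i"
  define d1 where "d1 = (z (i + 1) - z i) / h"
  define d2 where "d2 = (z (i + 2) - 2 * z (i + 1) + z i) / (2 * h\<^sup>2)"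
  define p where "p = [:z i:] + smult d1 [:- ?a, 1:] + smult d2 ([:- ?a, 1:] * [:- (?a + h), 1:])"
  have "degree p \<le> 2" by (simp add: p_def)
  moreover have "poly p (grid h k) = z k" if "k \<in> {i, i + 1, i + 2}" for k
    using that h unfolding p_def d1_def d2_def grid_def
    by (auto simp: field_simps power2_eq_square)
  ultimately have "quad_interp h z i = p"
    unfolding quad_interp_def by (intro the1_equality quad_interp_unique h) blast
  then have "poly (pderiv (quad_interp h z i)) s = d1 + d2 * (2 * s - 2 * ?a - h)"
    by (simp add: p_def pderiv_add pderiv_smult pderiv_mult pderiv_pCons algebra_simps)
  also have "\<dots> = ((z (i + 2) - z (i + 1)) * (s - ?a - h / 2) + (z (i + 1) - z i) * (?a + 3 * h / 2 - s)) / h\<^sup>2"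
    using h by (simp add: d1_def d2_def field_simps power2_eq_square)
  finally show ?thesis .
qed

lemma has_integral_rescale:
  fixes f :: "real \<Rightarrow> real"
  assumes "(f has_integral I) {c..d}" "h > 0" "c \<le> d"
  shows "((\<lambda>s. f ((b - s) / h)) has_integral h * I) {b - h * d..b - h * c}"
proof -
  have eq: "b / h - s / h = (b - s) / h" for s by (simp add: diff_divide_distrib)
  have "(\<lambda>x. - (h * x) + b) ` {c..d} = {b - h * d..b - h * c}"
    using assms image_affinity_atLeastAtMost[of "-h" b c d] by simp
  then show ?thesis
    using has_integral_affinity[of f I c d "- 1 / h" "b / h"] assms
    by (simp add: eq)
qed

lemma kernel_mult:
  assumes "h > 0" "0 \<le> x"
  shows "kernel \<nu> (h * x) = h powr (- \<nu>) / Gamma (1 - \<nu>) * x powr (- \<nu>)"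
  using assms by (simp add: kernel_def powr_mult)

lemma has_integral_block:
  assumes h: "h > 0" and \<nu>: "\<nu> < 1" and j: "j = i + 2 + t"
  shows "((\<lambda>s. poly (pderiv (quad_interp h z i)) s * kernel \<nu> (grid h j - s)) has_integral
     h powr (- \<nu>) / Gamma (1 - \<nu>) *
       (right_weight \<nu> (real t) * (z (i + 2) - z (i + 1)) + left_weight \<nu> (real t) * (z (i + 1) - z i)))
     {grid h i..grid h (i + 2)}"
proof -
  let ?dr = "z (i + 2) - z (i + 1)" and ?dl = "z (i + 1) - z i"
  let ?c = "h powr (- \<nu>) / Gamma (1 - \<nu>)"
  let ?f = "\<lambda>u::real. ?c / h * ((t + u) powr (- \<nu>) * (3 / 2 - u) * ?dr + (t + u) powr (- \<nu>) * (u - 1 / 2) * ?dl)"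
  have "(?f has_integral ?c / h * (right_weight \<nu> (real t) * ?dr + left_weight \<nu> (real t) * ?dl)) {0..2}"
    using \<nu> by (intro has_integral_mult_right has_integral_add has_integral_mult_left has_integral_right_weight has_integral_left_weight) auto
  from has_integral_rescale[OF this h, of "grid h (i + 2)"]
  have "((\<lambda>s. ?f ((grid h (i + 2) - s) / h)) has_integral ?c * (right_weight \<nu> (real t) * ?dr + left_weight \<nu> (real t) * ?dl))
      {grid h i..grid h (i + 2)}"
    using h by (simp add: grid_def algebra_simps)
  then show ?thesis
  proof (rule has_integral_eq[rotated])
    fix s assume s: "s \<in> {grid h i..grid h (i + 2)}"
    define u where "u = (grid h (i + 2) - s) / h"
    have u: "0 \<le> u" using s h by (simp add: u_def)
    have su: "s = grid h (i + 2) - h * u" using h by (simp add: u_def)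
    have "grid h j - s = h * (t + u)" by (simp add: su j grid_def algebra_simps)
    then have K: "kernel \<nu> (grid h j - s) = ?c * (t + u) powr (- \<nu>)"
      using kernel_mult[OF h, of "t + u" \<nu>] u by simp
    have P: "poly (pderiv (quad_interp h z i)) s = ((3 / 2 - u) * ?dr + (u - 1 / 2) * ?dl) / h"
      unfolding quad_interp_pderiv[OF h] su using h
      by (simp add: grid_def field_simps power2_eq_square)
    show "?f ((grid h (i + 2) - s) / h) = poly (pderiv (quad_interp h z i)) s * kernel \<nu> (grid h j - s)"
      unfolding u_def[symmetric] P K by (simp add: algebra_simps add_divide_distrib diff_divide_distrib)
  qed
qed

lemma has_integral_first_cell:
  assumes h: "h > 0" and \<nu>: "\<nu> < 1" and j: "j = Suc t"
  shows "((\<lambda>s. poly (pderiv (quad_interp h z 0)) s * kernel \<nu> (grid h j - s)) has_integral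
     h powr (- \<nu>) / Gamma (1 - \<nu>) * first_weight \<nu> (real t) (z 1 - z 0) (z 2 - z 1))
     {grid h 0..grid h 1}"
proof -
  let ?c = "h powr (- \<nu>) / Gamma (1 - \<nu>)"
  let ?f = "\<lambda>u::real. ?c / h * ((t + u) powr (- \<nu>) * ((z 1 - z 0) * (u + 1 / 2) + (z 2 - z 1) * (1 / 2 - u)))"
  have "(?f has_integral ?c / h * first_weight \<nu> (real t) (z 1 - z 0) (z 2 - z 1)) {0..1}"
    using \<nu> by (intro has_integral_mult_right has_integral_first_weight) auto
  from has_integral_rescale[OF this h, of "grid h 1"]
  have "((\<lambda>s. ?f ((grid h 1 - s) / h)) has_integral ?c * first_weight \<nu> (real t) (z 1 - z 0) (z 2 - z 1))
      {grid h 0..grid h 1}"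
    using h by (simp add: grid_def)
  then show ?thesis
  proof (rule has_integral_eq[rotated])
    fix s assume s: "s \<in> {grid h 0..grid h 1}"
    define u where "u = (grid h 1 - s) / h"
    have u: "0 \<le> u" using s h by (simp add: u_def)
    have su: "s = h * (1 - u)" using h by (simp add: u_def grid_def field_simps)
    have "grid h j - s = h * (t + u)" by (simp add: su j grid_def algebra_simps)
    then have "kernel \<nu> (grid h j - s) = ?c * (t + u) powr (- \<nu>)"
      using kernel_mult[OF h, of "t + u" \<nu>] u by simp
    moreover have "poly (pderiv (quad_interp h z 0)) s = ((z 1 - z 0) * (u + 1 / 2) + (z 2 - z 1) * (1 / 2 - u)) / h"
      unfolding quad_interp_pderiv[OF h] su using h
      by (simp add: grid_def numeral_2_eq_2 field_simps power2_eq_square)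
    ultimately show "?f ((grid h 1 - s) / h) = poly (pderiv (quad_interp h z 0)) s * kernel \<nu> (grid h j - s)"
      unfolding u_def[symmetric] by (simp add: mult_ac)
  qed
qed

lemma piece_first:
  assumes "odd j" "s \<le> grid h 1"
  shows "piece h z j s = quad_interp h z 0"
  using assms by (simp add: piece_def)

text \<open>Writing the left end as \<open>2 * k + j mod 2\<close> handles both parities, including
  \<open>j \<le> 2\<close>, at once. The left end is excluded because the \<open>LEAST\<close>
  assigns a shared node to the piece on its left.\<close>

lemma piece_block:
  assumes h: "h > 0" and k: "k < j div 2"
    and s: "grid h (2 * k + j mod 2) < s" "s \<le> grid h (2 * k + j mod 2 + 2)"
  shows "piece h z j s = quad_interp h z (2 * k + j mod 2)"
proof (cases "j \<le> 2")
  case True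
  then have "j = 2" "k = 0" using k by auto
  then show ?thesis by (simp add: piece_def)
next
  case j: False
  show ?thesis
  proof (cases "odd j")
    case True
    then have m: "j mod 2 = 1" by presburger
    have "grid h 1 \<le> grid h (2 * k + 1)" using h by (simp add: grid_def)
    then have "\<not> s \<le> grid h 1" using s m by simp
    moreover have "(LEAST k. s \<le> grid h (2 * k + 1)) = Suc k"
      using Least_piece[OF h, of k 1 s] s m by (simp add: add.commute add.left_commute)
    ultimately show ?thesis using j True m by (simp add: piece_def)
  next
    case False
    then have m: "j mod 2 = 0" by presburger
    have "(LEAST k. s \<le> grid h (2 * k + 2)) = k"
    proof (cases k)
      case 0
      show ?thesis by (rule Least_equality) (use s m 0 in auto)
    next
      case (Suc l)
      then show ?thesis using Least_piece[OF h, of l 2 s] s m by simp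
    qed
    then show ?thesis using j False m by (simp add: piece_def)
  qed
qed

lemma has_integral_chain:
  fixes f :: "real \<Rightarrow> real"
  assumes "\<And>k. k < n \<Longrightarrow> (f has_integral I k) {c k..c (Suc k)}" "\<And>k. c k \<le> c (Suc k)"
  shows "(f has_integral (\<Sum>k<n. I k)) {c 0..c n}"
  using assms(1)
proof (induction n)
  case 0
  then show ?case by (simp add: has_integral_refl)
next
  case (Suc n)
  have "c 0 \<le> c n" using lift_Suc_mono_le[of c 0 n] assms(2) by simp
  then show ?case using Suc assms(2)[of n] by (auto intro!: has_integral_combine[of "c 0" "c n" "c (Suc n)"])
qed

lemma grid_mono: "h > 0 \<Longrightarrow> i \<le> j \<Longrightarrow> grid h i \<le> grid h j"
  by (simp add: grid_def)

text \<open>The integrand is arbitrary because the same decomposition serves the discrete derivative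
  and its truncation error.\<close>

lemma has_integral_grid_blocks:
  fixes f :: "real \<Rightarrow> real"
  assumes h: "h > 0"
    and first: "odd j \<Longrightarrow> (f has_integral I0) {grid h 0..grid h 1}"
    and block: "\<And>k. k < j div 2 \<Longrightarrow> (f has_integral I k) {grid h (2 * k + j mod 2)..grid h (2 * k + j mod 2 + 2)}"
  shows "(f has_integral (if odd j then I0 else 0) + (\<Sum>k<j div 2. I k)) {0..grid h j}"
proof -
  have "(f has_integral (\<Sum>k<j div 2. I k)) {grid h (2 * 0 + j mod 2)..grid h (2 * (j div 2) + j mod 2)}"
    by (rule has_integral_chain[where c = "\<lambda>k. grid h (2 * k + j mod 2)"])
       (use block h in \<open>auto intro: grid_mono simp: algebra_simps\<close>)
  then have b: "(f has_integral (\<Sum>k<j div 2. I k)) {grid h (j mod 2)..grid h j}" by simp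
  show ?thesis
  proof (cases "odd j")
    case True
    then have "j mod 2 = 1" by presburger
    moreover have "grid h 1 \<le> grid h j" using True h by (auto intro!: grid_mono elim: oddE)
    ultimately show ?thesis
      using has_integral_combine[of "grid h 0" "grid h 1" "grid h j" f I0] first[OF True] b True h
      by (auto simp: grid_def)
  next
    case False
    then have "j mod 2 = 0" by presburger
    then show ?thesis using b False by (simp add: grid_def)
  qed
qed

section \<open>Interpolation error and integration against the kernel\<close>

lemma MVT_within:
  fixes f f' :: "real \<Rightarrow> real"
  assumes "\<And>s. s \<in> {a..b} \<Longrightarrow> (f has_real_derivative f' s) (at s within {a..b})"
    and "a \<le> x" "x < y" "y \<le> b"
  obtains z where "x < z" "z < y" "f y - f x = f' z * (y - x)"
proof -
  have "\<exists>z\<in>{x<..<y}. f y - f x = (*) (f' z) (y - x)"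
  proof (rule mvt_simple[OF \<open>x < y\<close>])
    fix s assume "x \<le> s" "s \<le> y"
    then have "(f has_real_derivative f' s) (at s within {x..y})"
      using assms by (intro DERIV_subset[OF assms(1)]) auto
    then show "(f has_derivative (*) (f' s)) (at s within {x..y})"
      by (simp add: has_field_derivative_def)
  qed
  then show ?thesis using that by auto
qed

lemma abs_diff_le_within:
  fixes f f' :: "real \<Rightarrow> real"
  assumes d: "\<And>s. s \<in> {a..b} \<Longrightarrow> (f has_real_derivative f' s) (at s within {a..b})"
    and B: "\<And>s. s \<in> {a..b} \<Longrightarrow> \<bar>f' s\<bar> \<le> B" and xy: "x \<in> {a..b}" "y \<in> {a..b}"
  shows "\<bar>f y - f x\<bar> \<le> B * (b - a)"
proof -
  have B0: "0 \<le> B" using B[OF xy(1)] by simp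
  have *: "\<bar>f y - f x\<bar> \<le> B * (b - a)" if xy: "x < y" "a \<le> x" "y \<le> b" for x y
  proof -
    obtain z where z: "x < z" "z < y" "f y - f x = f' z * (y - x)"
      by (rule MVT_within[OF d]) (use xy in auto)
    then show ?thesis using xy B0 B[of z] by (auto simp: abs_mult intro!: mult_mono)
  qed
  show ?thesis using *[of x y] *[of y x] xy B0 by (cases x y rule: linorder_cases) auto
qed

text \<open>The three zeros of \<open>E\<close> force two zeros of \<open>E1\<close> and hence one
  of \<open>E2\<close>. Integrating the bound for \<open>E3\<close> back twice from these zeros,
  each time over a length of at most \<open>2 * h\<close>, yields the constant 4.\<close>

lemma interpolation_error_deriv:
  fixes E E1 E2 E3 :: "real \<Rightarrow> real"
  assumes h: "h > 0"
    and E: "\<And>s. s \<in> {a..a + 2 * h} \<Longrightarrow> (E has_real_derivative E1 s) (at s within {a..a + 2 * h})"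
    and E1: "\<And>s. s \<in> {a..a + 2 * h} \<Longrightarrow> (E1 has_real_derivative E2 s) (at s within {a..a + 2 * h})"
    and E2: "\<And>s. s \<in> {a..a + 2 * h} \<Longrightarrow> (E2 has_real_derivative E3 s) (at s within {a..a + 2 * h})"
    and E3: "\<And>s. s \<in> {a..a + 2 * h} \<Longrightarrow> \<bar>E3 s\<bar> \<le> M"
    and zeros: "E a = 0" "E (a + h) = 0" "E (a + 2 * h) = 0"
    and s: "s \<in> {a..a + 2 * h}"
  shows "\<bar>E1 s\<bar> \<le> 4 * h\<^sup>2 * M"
proof -
  obtain u where u: "a < u" "u < a + h" "E (a + h) - E a = E1 u * (a + h - a)"
    by (rule MVT_within[OF E, of a "a + h"]) (use h in auto)
  obtain v where v: "a + h < v" "v < a + 2 * h" "E (a + 2 * h) - E (a + h) = E1 v * (a + 2 * h - (a + h))"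
    by (rule MVT_within[OF E, of "a + h" "a + 2 * h"]) (use h in auto)
  have 0: "E1 u = 0" "E1 v = 0" using u v zeros h by auto
  obtain w where w: "u < w" "w < v" "E1 v - E1 u = E2 w * (v - u)"
    by (rule MVT_within[OF E1, of u v]) (use u v in auto)
  have "E2 w = 0" using w 0 by auto
  then have "\<bar>E2 x\<bar> \<le> M * (2 * h)" if "x \<in> {a..a + 2 * h}" for x
    using abs_diff_le_within[OF E2 E3 _ that, of w] u v w by auto
  then have "\<bar>E1 s - E1 u\<bar> \<le> M * (2 * h) * (2 * h)"
    using abs_diff_le_within[OF E1 _ _ s, of "M * (2 * h)" u] u h by auto
  then show ?thesis using 0 by (simp add: power2_eq_square mult_ac)
qed

text \<open>Since \<open>e\<close> has mean zero, the constant \<open>g a\<close> can be subtracted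
  from \<open>g\<close> without changing the integral.\<close>

lemma abs_integral_oscillation_le:
  fixes e g :: "real \<Rightarrow> real"
  assumes ab: "a \<le> b" and I: "((\<lambda>s. e s * g s) has_integral I) {a..b}"
    and 0: "(e has_integral 0) {a..b}"
    and e: "\<And>s. s \<in> {a..b} \<Longrightarrow> \<bar>e s\<bar> \<le> m" and g: "\<And>s. s \<in> {a..b} \<Longrightarrow> g a \<le> g s \<and> g s \<le> g b"
  shows "\<bar>I\<bar> \<le> m * (b - a) * (g b - g a)"
proof -
  have m: "0 \<le> m" using e[of a] ab by auto
  have "((\<lambda>s. e s * g s - e s * g a) has_integral I - 0 * g a) {a..b}"
    by (intro has_integral_diff I has_integral_mult_left 0)
  then have "norm (I - 0 * g a) \<le> (m * (g b - g a)) * measure lborel {a..b}"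
  proof (rule has_integral_bound_real[rotated 2, of _ _ _ _ "{}"])
    show "norm (e s * g s - e s * g a) \<le> m * (g b - g a)" if "s \<in> {a..b} - {}" for s
    proof -
      have "\<bar>e s\<bar> * \<bar>g s - g a\<bar> \<le> m * (g b - g a)"
        using e[of s] g[of s] m that by (intro mult_mono) auto
      then show ?thesis by (simp add: abs_mult right_diff_distrib[symmetric])
    qed
    show "0 \<le> m * (g b - g a)" using m g[of b] ab by simp
  qed auto
  then show ?thesis using ab by (simp add: mult_ac)
qed

lemma kernel_nonneg: "\<nu> < 1 \<Longrightarrow> 0 \<le> kernel \<nu> x"
  unfolding kernel_def by (intro divide_nonneg_pos Gamma_real_pos) auto

lemma kernel_antimono:
  assumes "0 < \<nu>" "\<nu> < 1" "0 < x" "x \<le> y"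
  shows "kernel \<nu> y \<le> kernel \<nu> x"
  unfolding kernel_def using assms Gamma_real_pos[of "1 - \<nu>"]
  by (intro divide_right_mono powr_mono2') auto

lemma has_integral_kernel:
  assumes \<nu>: "0 < \<nu>" "\<nu> < 1" and ab: "a \<le> b" "b \<le> x"
  shows "((\<lambda>s. kernel \<nu> (x - s)) has_integral
           ((x - a) powr (1 - \<nu>) - (x - b) powr (1 - \<nu>)) / ((1 - \<nu>) * Gamma (1 - \<nu>))) {a..b}"
proof -
  have "((\<lambda>u. (0 + u) powr (- \<nu>) * (1 / Gamma (1 - \<nu>) + 0 * u)) has_integral
      (1 / Gamma (1 - \<nu>) - 0 * 0) * ((0 + (x - a)) powr (1 - \<nu>) - (0 + (x - b)) powr (1 - \<nu>)) / (1 - \<nu>) +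
      0 * ((0 + (x - a)) powr (2 - \<nu>) - (0 + (x - b)) powr (2 - \<nu>)) / (2 - \<nu>)) {x - b..x - a}"
    using \<nu> ab by (intro has_integral_powr_affine) auto
  from has_integral_rescale[OF this, of 1 x] show ?thesis
    using ab by (simp add: kernel_def mult.commute)
qed

lemma integrable_mult_kernel:
  assumes \<nu>: "0 < \<nu>" "\<nu> < 1" and ab: "a \<le> b" "b \<le> x" and f: "continuous_on {a..b} f"
  shows "(\<lambda>s. f s * kernel \<nu> (x - s)) integrable_on {a..b}"
proof -
  have "(\<lambda>s. kernel \<nu> (x - s)) absolutely_integrable_on {a..b}"
    using has_integral_kernel[OF \<nu> ab] kernel_nonneg[OF \<nu>(2)]
    by (intro nonnegative_absolutely_integrable_1) (auto intro: has_integral_integrable)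
  moreover have "f \<in> borel_measurable (lebesgue_on {a..b})"
    using f by (intro continuous_imp_measurable_on_sets_lebesgue) auto
  moreover have "bounded (f ` {a..b})"
    using f by (intro compact_imp_bounded compact_continuous_image) auto
  ultimately have "(\<lambda>s. f s * kernel \<nu> (x - s)) absolutely_integrable_on {a..b}"
    by (intro absolutely_integrable_bounded_measurable_product_real) auto
  then show ?thesis by (rule absolutely_integrable_on_def[THEN iffD1, THEN conjunct1])
qed

lemma has_integral_caputo_discrete:
  assumes h: "h > 0" and \<nu>: "\<nu> < 1"
  shows "((\<lambda>s. Pi_interp_deriv h z j s * kernel \<nu> (grid h j - s)) has_integral
     h powr (- \<nu>) / Gamma (1 - \<nu>) *
       ((if odd j then first_weight \<nu> (real (j - 1)) (z 1 - z 0) (z 2 - z 1) else 0) +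
        (\<Sum>k<j div 2. right_weight \<nu> (real (j - (2 * k + j mod 2 + 2))) * (z (2 * k + j mod 2 + 2) - z (2 * k + j mod 2 + 1)) +
                      left_weight \<nu> (real (j - (2 * k + j mod 2 + 2))) * (z (2 * k + j mod 2 + 1) - z (2 * k + j mod 2)))))
     {0..grid h j}"
proof -
  let ?f = "\<lambda>s. Pi_interp_deriv h z j s * kernel \<nu> (grid h j - s)"
  let ?c = "h powr (- \<nu>) / Gamma (1 - \<nu>)"
  let ?I = "\<lambda>k. ?c * (right_weight \<nu> (real (j - (2 * k + j mod 2 + 2))) * (z (2 * k + j mod 2 + 2) - z (2 * k + j mod 2 + 1)) +
                      left_weight \<nu> (real (j - (2 * k + j mod 2 + 2))) * (z (2 * k + j mod 2 + 1) - z (2 * k + j mod 2)))"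
  have "(?f has_integral (if odd j then ?c * first_weight \<nu> (real (j - 1)) (z 1 - z 0) (z 2 - z 1) else 0) + (\<Sum>k<j div 2. ?I k))
     {0..grid h j}"
  proof (rule has_integral_grid_blocks[OF h])
    assume j: "odd j"
    then have "j = Suc (j - 1)" by (auto elim: oddE)
    from has_integral_first_cell[OF h \<nu> this, of z]
    show "(?f has_integral ?c * first_weight \<nu> (real (j - 1)) (z 1 - z 0) (z 2 - z 1)) {grid h 0..grid h 1}"
      by (rule has_integral_eq[rotated]) (use j in \<open>auto simp: Pi_interp_deriv_def piece_first\<close>)
  next
    fix k assume k: "k < j div 2"
    define i where "i = 2 * k + j mod 2"
    have "i + 2 \<le> j" using k mult_div_mod_eq[of 2 j] unfolding i_def by linarith
    then have "j = i + 2 + (j - (i + 2))" by simp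
    \<comment> \<open>At the left end of the block the interpolant still uses the preceding piece;
      this single point does not affect the integral.\<close>
    from has_integral_block[OF h \<nu> this, of z]
    have "(?f has_integral ?I k) {grid h i..grid h (i + 2)}"
      unfolding i_def[symmetric]
      by (rule has_integral_spike_finite[rotated -1, of _ _ _ "{grid h i}"])
         (use piece_block[OF h k, of _ z] in \<open>auto simp: Pi_interp_deriv_def i_def\<close>)
    then show "(?f has_integral ?I k) {grid h (2 * k + j mod 2)..grid h (2 * k + j mod 2 + 2)}"
      by (simp add: i_def)
  qed
  then show ?thesis
    unfolding sum_distrib_left[symmetric]
    by (cases "odd j") (simp_all only: if_True if_False not_True_eq_False not_False_eq_True distrib_left mult_zero_right)
qed

text \<open>\<open>caputo\<close> takes derivatives within \<open>{0..x}\<close>, the regularity of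
  \<open>y\<close> is stated within \<open>{0..T}\<close>. For \<open>x > 0\<close> the two
  derivatives agree on \<open>{0..x}\<close>, also at its endpoints.\<close>

lemma caputo_has_integral:
  assumes \<nu>: "0 < \<nu>" "\<nu> < 1" and x: "0 < x" "x \<le> T"
    and y: "\<And>s. s \<in> {0..T} \<Longrightarrow> (y has_real_derivative y' s) (at s within {0..T})"
    and c: "continuous_on {0..T} y'"
  shows "((\<lambda>s. y' s * kernel \<nu> (x - s)) has_integral caputo \<nu> y x) {0..x}"
proof -
  have "continuous_on {0..x} y'" using c by (rule continuous_on_subset) (use x in auto)
  then have i: "(\<lambda>s. y' s * kernel \<nu> (x - s)) integrable_on {0..x}"
    using x by (intro integrable_mult_kernel \<nu>) auto
  have "caputo \<nu> y x = integral {0..x} (\<lambda>s. y' s * kernel \<nu> (x - s))"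
    unfolding caputo_def
  proof (rule integral_cong)
    fix s assume s: "s \<in> {0..x}"
    have "(y has_real_derivative y' s) (at s within {0..x})"
      using s x by (intro DERIV_subset[OF y]) auto
    then have "vector_derivative y (at s within {0..x}) = y' s"
      using s x by (intro vector_derivative_within_closed_interval)
        (auto simp: has_real_derivative_iff_has_vector_derivative)
    then show "kernel \<nu> (x - s) * vector_derivative y (at s within {0..x}) = y' s * kernel \<nu> (x - s)"
      by simp
  qed
  then show ?thesis using integrable_integral[OF i] by simp
qed

section \<open>Truncation error\<close>

text \<open>The second claim allows any two of the three nodes, because the leftover cell of an odd
  step is only half a block; the integral vanishes as the interpolation error is zero at both
  ends.\<close>

lemma quad_interp_error:
  fixes D :: "nat \<Rightarrow> real \<Rightarrow> real"
  assumes h: "h > 0" and i: "grid h (i + 2) \<le> T"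
    and D: "\<And>n s. n < 3 \<Longrightarrow> s \<in> {0..T} \<Longrightarrow> (D n has_real_derivative D (Suc n) s) (at s within {0..T})"
    and M: "\<And>s. s \<in> {0..T} \<Longrightarrow> \<bar>D 3 s\<bar> \<le> M"
  defines "e \<equiv> (\<lambda>s. poly (pderiv (quad_interp h (\<lambda>k. D 0 (grid h k)) i)) s - D 1 s)"
  shows "s \<in> {grid h i..grid h (i + 2)} \<Longrightarrow> \<bar>e s\<bar> \<le> 4 * h\<^sup>2 * M"
    and "a \<in> {i, i + 1, i + 2} \<Longrightarrow> b \<in> {i, i + 1, i + 2} \<Longrightarrow> a \<le> b \<Longrightarrow> (e has_integral 0) {grid h a..grid h b}"
proof -
  define q where "q = quad_interp h (\<lambda>k. D 0 (grid h k)) i"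
  define p where "p n = (pderiv ^^ n) q" for n
  have q: "degree q \<le> 2" "\<And>k. k \<in> {i, i + 1, i + 2} \<Longrightarrow> poly q (grid h k) = D 0 (grid h k)"
    using quad_interp_poly[OF h] by (auto simp: q_def)
  have sub: "{grid h a..grid h b} \<subseteq> {0..T}" if "b \<le> i + 2" for a b
  proof -
    have "0 \<le> grid h a" "grid h b \<le> grid h (i + 2)" using h that by (auto simp: grid_def)
    then show ?thesis using i by auto
  qed
  have E: "((\<lambda>s. poly (p n) s - D n s) has_real_derivative poly (p (Suc n)) s - D (Suc n) s) (at s within S)"
    if "n < 3" "S \<subseteq> {0..T}" "s \<in> S" for n s S
  proof (rule DERIV_diff)
    show "(poly (p n) has_real_derivative poly (p (Suc n)) s) (at s within S)"
      by (auto simp: p_def intro: DERIV_subset[OF poly_DERIV])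
    show "(D n has_real_derivative D (Suc n) s) (at s within S)"
      using that by (intro DERIV_subset[OF D]) auto
  qed
  have p3: "p 3 = 0"
  proof -
    have "degree (p n) \<le> 2 - n" for n
      using q(1) by (induction n) (auto simp: p_def degree_pderiv)
    from this[of 2] have "degree (p 2) = 0" by simp
    then have "pderiv (p 2) = 0" by (simp add: pderiv_eq_0_iff)
    then show ?thesis by (simp add: p_def numeral_3_eq_3 numeral_2_eq_2)
  qed
  have e: "e = (\<lambda>s. poly (p 1) s - D 1 s)" by (simp add: e_def p_def q_def)
  have g: "grid h (i + 2) = grid h i + 2 * h" "grid h (i + 1) = grid h i + h"
    by (simp_all add: grid_def algebra_simps)
  show "\<bar>e s\<bar> \<le> 4 * h\<^sup>2 * M" if s: "s \<in> {grid h i..grid h (i + 2)}"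
  proof -
    have sub': "{grid h i..grid h i + 2 * h} \<subseteq> {0..T}" using sub[of "i + 2" i] g by simp
    let ?S = "{grid h i..grid h i + 2 * h}"
    let ?E = "\<lambda>n s. poly (p n) s - D n s"
    have d: "(?E n has_real_derivative ?E (Suc n) s) (at s within ?S)" if "s \<in> ?S" "n < 3" for n s
      using E[OF that(2) sub' that(1)] .
    have d1: "(?E 1 has_real_derivative ?E 2 s) (at s within ?S)" if "s \<in> ?S" for s
      using d[OF that, of 1] by (simp add: numeral_2_eq_2)
    have d2: "(?E 2 has_real_derivative ?E 3 s) (at s within ?S)" if "s \<in> ?S" for s
      using d[OF that, of 2] by simp
    have d3: "\<bar>?E 3 s\<bar> \<le> M" if "s \<in> ?S" for s
      using M[of s] sub' that by (auto simp: p3)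
    have d0: "(?E 0 has_real_derivative ?E 1 s) (at s within ?S)" if "s \<in> ?S" for s
      using d[OF that, of 0] by simp
    have "\<bar>?E 1 s\<bar> \<le> 4 * h\<^sup>2 * M"
      by (rule interpolation_error_deriv[OF h d0 d1 d2 d3])
         (use q(2)[of i] q(2)[of "i + 1"] q(2)[of "i + 2"] g s in \<open>simp_all add: p_def\<close>)
    then show ?thesis by (simp add: e)
  qed
  show "(e has_integral 0) {grid h a..grid h b}"
    if ab: "a \<in> {i, i + 1, i + 2}" "b \<in> {i, i + 1, i + 2}" "a \<le> b"
  proof -
    have "(e has_integral (poly (p 0) (grid h b) - D 0 (grid h b)) - (poly (p 0) (grid h a) - D 0 (grid h a))) {grid h a..grid h b}"
      unfolding e
    proof (rule fundamental_theorem_of_calculus)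
      fix s assume s: "s \<in> {grid h a..grid h b}"
      have "{grid h a..grid h b} \<subseteq> {0..T}" using sub[of b a] ab by auto
      from E[OF _ this s, of 0]
      show "((\<lambda>s. poly (p 0) s - D 0 s) has_vector_derivative poly (p 1) s - D 1 s) (at s within {grid h a..grid h b})"
        by (simp add: has_real_derivative_iff_has_vector_derivative)
    qed (use grid_mono[OF h] ab in auto)
    then show "(e has_integral 0) {grid h a..grid h b}"
      using q(2)[of a] q(2)[of b] ab by (simp add: p_def)
  qed
qed

text \<open>Telescoping leaves one kernel value at distance \<open>2 * h\<close>, and
  \<open>2 * h * kernel \<nu> (2 * h)\<close> has the same order \<open>h powr (1 - \<nu>)\<close>
  as the integral of the kernel over the last block. Near and far parts therefore lose equally
  little, and the factor \<open>h\<^sup>2\<close> of the interpolation error completes the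
  order.\<close>

lemma truncation_error:
  fixes D :: "nat \<Rightarrow> real \<Rightarrow> real"
  assumes \<nu>: "0 < \<nu>" "\<nu> < 1" and h: "h > 0" and j: "1 \<le> j" "grid h j \<le> T" "grid h 2 \<le> T"
    and D: "\<And>n s. n < 3 \<Longrightarrow> s \<in> {0..T} \<Longrightarrow> (D n has_real_derivative D (Suc n) s) (at s within {0..T})"
    and M: "\<And>s. s \<in> {0..T} \<Longrightarrow> \<bar>D 3 s\<bar> \<le> M"
  shows "\<bar>caputo_discrete \<nu> h (\<lambda>k. D 0 (grid h k)) j - caputo \<nu> (D 0) (grid h j)\<bar> \<le>
    4 * M * 2 powr (1 - \<nu>) * (2 - \<nu>) / ((1 - \<nu>) * Gamma (1 - \<nu>)) * h powr (3 - \<nu>)"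
proof -
  define z where "z = (\<lambda>k. D 0 (grid h k))"
  define x where "x = grid h j"
  define ker where "ker = (\<lambda>s. kernel \<nu> (x - s))"
  define e where "e i s = poly (pderiv (quad_interp h z i)) s - D 1 s" for i s
  define G where "G = (1 - \<nu>) * Gamma (1 - \<nu>)"
  define m where "m = 4 * h\<^sup>2 * M"
  define n where "n = j div 2"
  define p where "p = j mod 2"
  have jn: "j = 2 * n + p" by (simp add: n_def p_def)
  have p1: "p \<le> 1" by (simp add: p_def)
  have x0: "0 < x" using h j by (simp add: x_def grid_def)
  have G: "0 < G" using \<nu> by (simp add: G_def)
  have D1c: "continuous_on {0..T} (D 1)"
    using D[of 1] by (intro DERIV_continuous_on[of _ "D 1" "D 2"]) (auto simp: numeral_2_eq_2)
  have T: "0 \<in> {0..T}" using j x0 by (auto simp: x_def)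
  have M0: "0 \<le> M" using M[OF T] by simp
  have m0: "0 \<le> m" using M0 by (simp add: m_def)
  define R where "R a b i = integral {grid h a..grid h b} (\<lambda>s. e i s * ker s)" for a b i
  have mono: "grid h a \<le> grid h b" if "a \<le> b" for a b using grid_mono[OF h that] .
  have block: "((\<lambda>s. e i s * ker s) has_integral R a b i) {grid h a..grid h b}"
    if "a \<le> b" "b \<le> j" for a b i
  proof -
    have "0 \<le> grid h a" using h by (simp add: grid_def)
    moreover have "grid h b \<le> x" using mono[OF that(2)] by (simp add: x_def)
    moreover have "x \<le> T" using j by (simp add: x_def)
    ultimately have "continuous_on {grid h a..grid h b} (e i)"
      unfolding e_def by (intro continuous_intros continuous_on_subset[OF D1c]) auto
    then show ?thesis
      unfolding R_def ker_def using mono that \<open>grid h b \<le> x\<close>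
      by (intro integrable_integral integrable_mult_kernel \<nu>) auto
  qed
  have err: "\<bar>e i s\<bar> \<le> m" if "grid h (i + 2) \<le> T" "s \<in> {grid h i..grid h (i + 2)}" for i s
    using quad_interp_error(1)[OF h that(1) D M that(2)] by (simp add: e_def z_def m_def)
  have zero: "(e i has_integral 0) {grid h a..grid h b}"
    if "grid h (i + 2) \<le> T" "a \<in> {i, i + 1, i + 2}" "b \<in> {i, i + 1, i + 2}" "a \<le> b" for i a b
    using quad_interp_error(2)[OF h that(1) D M that(2-4)] by (simp add: e_def[abs_def] z_def)
  have far: "\<bar>R a b i\<bar> \<le> m * (2 * h) * (ker (grid h b) - ker (grid h a))"
    if i: "grid h (i + 2) \<le> T" "a \<in> {i, i + 1, i + 2}" "b \<in> {i, i + 1, i + 2}" "a \<le> b" "b < j" for i a b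
  proof -
    have bx: "grid h b < x" using that h by (simp add: x_def grid_def)
    have ker: "ker s \<le> ker s'" if "s \<le> s'" "s' \<le> grid h b" for s s'
      unfolding ker_def using that bx by (intro kernel_antimono \<nu>) auto
    have "\<bar>R a b i\<bar> \<le> m * (grid h b - grid h a) * (ker (grid h b) - ker (grid h a))"
    proof (rule abs_integral_oscillation_le)
      show "\<bar>e i s\<bar> \<le> m" if "s \<in> {grid h a..grid h b}" for s
        using i(2,3) mono[of i a] mono[of b "i + 2"] that by (intro err i) auto
      show "ker (grid h a) \<le> ker s \<and> ker s \<le> ker (grid h b)" if "s \<in> {grid h a..grid h b}" for s
        using that by (intro conjI ker) auto
      show "((\<lambda>s. e i s * ker s) has_integral R a b i) {grid h a..grid h b}"
        using i by (intro block) auto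
    qed (use zero[of i a b] i mono in auto)
    also have "\<dots> \<le> m * (2 * h) * (ker (grid h b) - ker (grid h a))"
      using i h m0 ker[of "grid h a" "grid h b"] mono[OF i(4)]
      by (intro mult_right_mono mult_left_mono) (auto simp: grid_def algebra_simps)
    finally show ?thesis .
  qed
  \<comment> \<open>Here the interval ends at the singularity, where the kernel has no finite
    oscillation, so its integral is bounded instead.\<close>
  have near: "\<bar>R a j i\<bar> \<le> m * (2 * h) powr (1 - \<nu>) / G"
    if i: "grid h (i + 2) \<le> T" "a \<in> {i, i + 1, i + 2}" "j \<in> {i, i + 1, i + 2}" "a \<le> j" for i a
  proof -
    have k: "((\<lambda>s. m * ker s) has_integral m * (((x - grid h a) powr (1 - \<nu>) - (x - grid h j) powr (1 - \<nu>)) / G)) {grid h a..grid h j}"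
      unfolding ker_def G_def using mono[OF i(4)]
      by (intro has_integral_mult_right has_integral_kernel \<nu>) (auto simp: x_def)
    have r: "((\<lambda>s. e i s * ker s) has_integral R a j i) {grid h a..grid h j}"
      using block i by auto
    have "norm (integral {grid h a..grid h j} (\<lambda>s. e i s * ker s)) \<le> integral {grid h a..grid h j} (\<lambda>s. m * ker s)"
    proof (rule integral_norm_bound_integral)
      fix s assume s: "s \<in> {grid h a..grid h j}"
      have "\<bar>e i s\<bar> \<le> m"
        using i(2,3) mono[of i a] mono[of j "i + 2"] s by (intro err i) auto
      then show "norm (e i s * ker s) \<le> m * ker s"
        using kernel_nonneg[OF \<nu>(2)] by (simp add: abs_mult ker_def mult_right_mono)
    qed (use k r in \<open>auto intro: has_integral_integrable\<close>)
    then have "\<bar>R a j i\<bar> \<le> m * ((x - grid h a) powr (1 - \<nu>) / G)"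
      using integral_unique[OF k] integral_unique[OF r] by (simp add: x_def)
    also have "\<dots> \<le> m * ((2 * h) powr (1 - \<nu>) / G)"
      using m0 G \<nu> i h by (intro mult_left_mono divide_right_mono powr_mono2) (auto simp: x_def grid_def algebra_simps)
    finally show ?thesis by simp
  qed
  have "((\<lambda>s. Pi_interp_deriv h z j s * kernel \<nu> (x - s)) has_integral caputo_discrete \<nu> h z j) {0..x}"
    using has_integral_caputo_discrete[OF h \<nu>(2), of z j] integrable_integral
    unfolding caputo_discrete_def x_def by (blast intro: has_integral_integrable)
  moreover have "((\<lambda>s. D 1 s * kernel \<nu> (x - s)) has_integral caputo \<nu> (D 0) x) {0..x}"
    using D[of 0] D1c x0 j by (intro caputo_has_integral[where T = T] \<nu>) (auto simp: x_def)
  ultimately have "((\<lambda>s. Pi_interp_deriv h z j s * kernel \<nu> (x - s) - D 1 s * kernel \<nu> (x - s))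
      has_integral caputo_discrete \<nu> h z j - caputo \<nu> (D 0) x) {0..x}"
    by (rule has_integral_diff)
  then have "((\<lambda>s. (Pi_interp_deriv h z j s - D 1 s) * ker s)
      has_integral caputo_discrete \<nu> h z j - caputo \<nu> (D 0) x) {0..x}"
    by (simp add: ker_def left_diff_distrib)
  moreover have "((\<lambda>s. (Pi_interp_deriv h z j s - D 1 s) * ker s) has_integral
      (if odd j then R 0 1 0 else 0) + (\<Sum>k<j div 2. R (2 * k + p) (2 * k + p + 2) (2 * k + p))) {0..grid h j}"
  proof (rule has_integral_grid_blocks[OF h])
    assume "odd j"
    then show "((\<lambda>s. (Pi_interp_deriv h z j s - D 1 s) * ker s) has_integral R 0 1 0) {grid h 0..grid h 1}"
      using j by (intro has_integral_eq[OF _ block[of 0 1 0]]) (auto simp: Pi_interp_deriv_def piece_first e_def)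
  next
    fix k assume k: "k < j div 2"
    then have "2 * k + p + 2 \<le> j" using jn unfolding n_def[symmetric] by linarith
    then have "((\<lambda>s. e (2 * k + p) s * ker s) has_integral R (2 * k + p) (2 * k + p + 2) (2 * k + p))
        {grid h (2 * k + p)..grid h (2 * k + p + 2)}" by (intro block) auto
    then show "((\<lambda>s. (Pi_interp_deriv h z j s - D 1 s) * ker s) has_integral R (2 * k + p) (2 * k + p + 2) (2 * k + p))
        {grid h (2 * k + j mod 2)..grid h (2 * k + j mod 2 + 2)}"
      unfolding p_def
      by (rule has_integral_spike_finite[rotated -1, of _ _ _ "{grid h (2 * k + j mod 2)}"])
         (use piece_block[OF h k, of _ z] in \<open>auto simp: Pi_interp_deriv_def e_def\<close>)
  qed
  ultimately have eq: "caputo_discrete \<nu> h z j - caputo \<nu> (D 0) x =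
      (if odd j then R 0 1 0 else 0) + (\<Sum>k<n. R (2 * k + p) (2 * k + p + 2) (2 * k + p))"
    unfolding x_def n_def by (rule has_integral_unique)
  have "\<bar>(if odd j then R 0 1 0 else 0) + (\<Sum>k<n. R (2 * k + p) (2 * k + p + 2) (2 * k + p))\<bar> \<le>
      m * (2 * h) * kernel \<nu> (2 * h) + m * (2 * h) powr (1 - \<nu>) / G"
  proof (cases n)
    case 0
    \<comment> \<open>For \<open>j = 1\<close> the only cell touches the singularity, and its
      interpolant reaches to the second node; hence the assumption
      \<open>grid h 2 \<le> T\<close>.\<close>
    then have "j = 1" using jn p1 j(1) by linarith
    then show ?thesis using near[of 0 0] 0 j(3) m0 h kernel_nonneg[OF \<nu>(2), of "2 * h"]
      by (simp add: numeral_2_eq_2 add_increasing)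
  next
    case (Suc n')
    define c where "c k = grid h (2 * k + p)" for k
    have T': "grid h (2 * k + p + 2) \<le> T" if "k < n" for k
    proof -
      have "2 * k + p + 2 \<le> j" using that jn by linarith
      then show ?thesis using mono[of "2 * k + p + 2" j] j by linarith
    qed
    have S: "(\<Sum>k<n'. \<bar>R (2 * k + p) (2 * k + p + 2) (2 * k + p)\<bar>) \<le> m * (2 * h) * (ker (c n') - ker (c 0))"
    proof -
      have "(\<Sum>k<n'. \<bar>R (2 * k + p) (2 * k + p + 2) (2 * k + p)\<bar>) \<le> (\<Sum>k<n'. m * (2 * h) * (ker (c (Suc k)) - ker (c k)))"
      proof (rule sum_mono)
        fix k assume "k \<in> {..<n'}"
        then show "\<bar>R (2 * k + p) (2 * k + p + 2) (2 * k + p)\<bar> \<le> m * (2 * h) * (ker (c (Suc k)) - ker (c k))"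
          using far[of "2 * k + p" "2 * k + p" "2 * k + p + 2"] T'[of k] Suc jn by (auto simp: c_def)
      qed
      also have "\<dots> = m * (2 * h) * (ker (c n') - ker (c 0))"
        using sum_lessThan_telescope[of "\<lambda>k. ker (c k)" n'] by (simp add: sum_distrib_left[symmetric])
      finally show ?thesis .
    qed
    have L: "\<bar>R (2 * n' + p) (2 * n' + p + 2) (2 * n' + p)\<bar> \<le> m * (2 * h) powr (1 - \<nu>) / G"
      using near[of "2 * n' + p" "2 * n' + p"] T'[of n'] Suc jn by simp
    \<comment> \<open>The bound \<open>ker (c 0)\<close> is exactly what the telescoped sum in
      \<open>S\<close> subtracts, so the leftover cell costs nothing extra.\<close>
    have F: "\<bar>if odd j then R 0 1 0 else 0\<bar> \<le> m * (2 * h) * ker (c 0)"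
    proof (cases "odd j")
      case True
      then have p: "p = 1" by (simp add: p_def odd_iff_mod_2_eq_one)
      have "\<bar>R 0 1 0\<bar> \<le> m * (2 * h) * (ker (c 0) - ker (grid h 0))"
        using far[of 0 0 1] j(3) jn Suc p by (simp add: c_def numeral_2_eq_2)
      also have "\<dots> \<le> m * (2 * h) * ker (c 0)"
        using m0 h kernel_nonneg[OF \<nu>(2)] by (intro mult_left_mono) (auto simp: ker_def)
      finally show ?thesis using True by simp
    next
      case False
      then show ?thesis using m0 h kernel_nonneg[OF \<nu>(2)] by (simp add: ker_def)
    qed
    have "x - c n' = 2 * h" using Suc jn by (simp add: x_def c_def grid_def algebra_simps)
    then have kc: "ker (c n') = kernel \<nu> (2 * h)" by (simp add: ker_def)
    have "\<bar>(if odd j then R 0 1 0 else 0) + (\<Sum>k<n. R (2 * k + p) (2 * k + p + 2) (2 * k + p))\<bar> \<le>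
       \<bar>if odd j then R 0 1 0 else 0\<bar> + ((\<Sum>k<n'. \<bar>R (2 * k + p) (2 * k + p + 2) (2 * k + p)\<bar>) +
       \<bar>R (2 * n' + p) (2 * n' + p + 2) (2 * n' + p)\<bar>)"
      unfolding Suc sum.lessThan_Suc
      by (intro order_trans[OF abs_triangle_ineq] add_mono order_refl sum_abs)
    also have "\<dots> \<le> m * (2 * h) * ker (c 0) + (m * (2 * h) * (ker (c n') - ker (c 0)) + m * (2 * h) powr (1 - \<nu>) / G)"
      using F S L by (intro add_mono) auto
    also have "\<dots> = m * (2 * h) * kernel \<nu> (2 * h) + m * (2 * h) powr (1 - \<nu>) / G"
      by (simp add: kc right_diff_distrib)
    finally show ?thesis .
  qed
  also have "m * (2 * h) * kernel \<nu> (2 * h) + m * (2 * h) powr (1 - \<nu>) / G =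
     m * ((2 * h) powr (1 - \<nu>) * (2 - \<nu>) / G)"
  proof -
    have "2 * h * kernel \<nu> (2 * h) = (2 * h) powr (1 - \<nu>) * (1 - \<nu>) / G"
      using h \<nu> powr_add[of "2 * h" 1 "- \<nu>"] by (simp add: kernel_def G_def)
    then have "m * (2 * h) * kernel \<nu> (2 * h) = m * ((2 * h) powr (1 - \<nu>) * (1 - \<nu>) / G)"
      by (simp only: mult.assoc)
    then show ?thesis by (simp add: algebra_simps add_divide_distrib diff_divide_distrib)
  qed
  also have "m * ((2 * h) powr (1 - \<nu>) * (2 - \<nu>) / G) =
     4 * M * 2 powr (1 - \<nu>) * (2 - \<nu>) / G * h powr (3 - \<nu>)"
  proof -
    have "h powr (3 - \<nu>) = h\<^sup>2 * h powr (1 - \<nu>)"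
      using h powr_add[of h 2 "1 - \<nu>"] by simp
    then show ?thesis using h by (simp add: m_def powr_mult)
  qed
  finally show ?thesis unfolding eq[symmetric] by (simp add: z_def x_def G_def)
qed

section \<open>Stability and convergence\<close>

lemma sum_even_odd_pairs: "(\<Sum>k<2 * n. f k) = (\<Sum>i<n. f (2 * i) + f (2 * i + 1 :: nat) :: real)"
  by (induction n) (simp_all add: add_ac)

text \<open>At an odd step the leftover cell has the even lag \<open>j - 1\<close>, so the
  convolution gives it a right cell weight. The extra term exchanges this for the true one, which
  also involves the second increment.\<close>

lemma caputo_discrete_eq_conv_diff:
  assumes h: "h > 0" and \<nu>: "\<nu> < 1" and j: "1 \<le> j"
  shows "Gamma (1 - \<nu>) * h powr \<nu> * caputo_discrete \<nu> h z j = conv_diff (step_weight \<nu>) z j +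
    (if odd j then first_weight \<nu> (real (j - 1)) (z 1 - z 0) (z 2 - z 1) - right_weight \<nu> (real (j - 1)) * (z 1 - z 0) else 0)"
proof -
  define n where "n = j div 2"
  define p where "p = j mod 2"
  have jn: "j = 2 * n + p" by (simp add: n_def p_def)
  let ?t = "\<lambda>k. right_weight \<nu> (real (j - (2 * k + p + 2))) * (z (2 * k + p + 2) - z (2 * k + p + 1)) +
                      left_weight \<nu> (real (j - (2 * k + p + 2))) * (z (2 * k + p + 1) - z (2 * k + p))"
  let ?w = "if odd j then first_weight \<nu> (real (j - 1)) (z 1 - z 0) (z 2 - z 1) else 0"
  have "caputo_discrete \<nu> h z j = h powr (- \<nu>) / Gamma (1 - \<nu>) * (?w + (\<Sum>k<n. ?t k))"
    unfolding caputo_discrete_def n_def p_def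
    by (rule integral_unique[OF has_integral_caputo_discrete[OF h \<nu>]])
  then have "Gamma (1 - \<nu>) * h powr \<nu> * caputo_discrete \<nu> h z j =
      (Gamma (1 - \<nu>) / Gamma (1 - \<nu>)) * (h powr \<nu> * h powr (- \<nu>)) * (?w + (\<Sum>k<n. ?t k))"
    by simp
  also have "\<dots> = ?w + (\<Sum>k<n. ?t k)"
  proof -
    have "0 < Gamma (1 - \<nu>)" using \<nu> by (intro Gamma_real_pos) auto
    then show ?thesis using h by (simp add: powr_minus)
  qed
  \<comment> \<open>The blocks are counted from the evaluation point backwards, so that a block's
    index determines its lags.\<close>
  also have "(\<Sum>k<n. ?t k) = (\<Sum>i<n. ?t (n - Suc i))"
    by (rule sum.nat_diff_reindex[symmetric])
  also have "\<dots> = (\<Sum>i<n. step_weight \<nu> (2 * i) * (z (j - 2 * i) - z (j - Suc (2 * i))) +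
      step_weight \<nu> (2 * i + 1) * (z (j - (2 * i + 1)) - z (j - Suc (2 * i + 1))))"
  proof (rule sum.cong[OF refl])
    fix i assume "i \<in> {..<n}"
    then obtain d where d: "n = i + 1 + d" by (metis lessThan_iff less_iff_Suc_add add_Suc_right add_Suc Suc_eq_plus1)
    have "n - Suc i = d" "2 * d + p + 2 = j - 2 * i" "2 * d + p + 1 = j - Suc (2 * i)" "2 * d + p = j - Suc (2 * i + 1)"
      "j - (j - 2 * i) = 2 * i"
      using d jn by simp_all
    then show "?t (n - Suc i) = step_weight \<nu> (2 * i) * (z (j - 2 * i) - z (j - Suc (2 * i))) +
      step_weight \<nu> (2 * i + 1) * (z (j - (2 * i + 1)) - z (j - Suc (2 * i + 1)))"
      by (simp add: step_weight_def)
  qed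
  also have "\<dots> = (\<Sum>k<2 * n. step_weight \<nu> k * (z (j - k) - z (j - Suc k)))"
    by (rule sum_even_odd_pairs[symmetric])
  also have "\<dots> = conv_diff (step_weight \<nu>) z j - (if odd j then right_weight \<nu> (real (j - 1)) * (z 1 - z 0) else 0)"
  proof (cases "odd j")
    case True
    then have "j = Suc (2 * n)" by (simp add: n_def)
    then show ?thesis by (simp add: conv_diff_def step_weight_def)
  next
    case False
    then have "j = 2 * n" by (simp add: n_def)
    then show ?thesis by (simp add: conv_diff_def)
  qed
  finally show ?thesis by auto
qed

text \<open>Linearity is read off from the explicit derivative of the interpolant, as
  \<open>quad_interp\<close> itself is given by a description.\<close>

lemma caputo_discrete_diff:
  assumes h: "h > 0" and \<nu>: "\<nu> < 1"
  shows "caputo_discrete \<nu> h (\<lambda>k. u k - v k) j = caputo_discrete \<nu> h u j - caputo_discrete \<nu> h v j"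
proof -
  have lin: "((a2 - b2) - (a1 - b1)) * x + ((a1 - b1) - (a0 - b0)) * y =
      ((a2 - a1) * x + (a1 - a0) * y) - ((b2 - b1) * x + (b1 - b0) * y)" for a0 a1 a2 b0 b1 b2 x y :: real
    by (simp add: algebra_simps)
  have q: "poly (pderiv (quad_interp h (\<lambda>k. u k - v k) i)) s =
      poly (pderiv (quad_interp h u i)) s - poly (pderiv (quad_interp h v i)) s" for i s
    unfolding quad_interp_pderiv[OF h] lin diff_divide_distrib ..
  have p: "Pi_interp_deriv h (\<lambda>k. u k - v k) j s = Pi_interp_deriv h u j s - Pi_interp_deriv h v j s" for s
    by (simp add: Pi_interp_deriv_def piece_def q)
  show ?thesis
    unfolding caputo_discrete_def p left_diff_distrib
    by (intro integral_diff has_integral_integrable[OF has_integral_caputo_discrete[OF h \<nu>]])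
qed

text \<open>Gamma equals 1 at both 1 and 2, so by log-convexity
  \<open>Gamma (2 - \<nu>) \<le> 1\<close>; the functional equation does the rest.\<close>

lemma Gamma_1_minus_le:
  assumes "0 < \<nu>" "\<nu> < 1"
  shows "Gamma (1 - \<nu>) \<le> 1 / (1 - \<nu> :: real)"
proof -
  have "(ln \<circ> Gamma) ((1 - \<nu>) *\<^sub>R 2 + \<nu> *\<^sub>R (1::real)) \<le> (1 - \<nu>) * (ln \<circ> Gamma) 2 + \<nu> * (ln \<circ> Gamma) (1::real)"
    by (rule convex_onD[OF log_convex_Gamma_real]) (use assms in auto)
  moreover have "Gamma (2::real) = 1" using Gamma_fact[of 1, where 'a = real] by simp
  ultimately have "ln (Gamma (2 - \<nu>)) \<le> 0" by (simp add: algebra_simps)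
  moreover have "0 < Gamma (2 - \<nu>)" using assms by (intro Gamma_real_pos) auto
  ultimately have "Gamma (2 - \<nu>) \<le> 1" by simp
  moreover have "Gamma (1 - \<nu> + 1) = (1 - \<nu>) * Gamma (1 - \<nu>)"
    using assms by (intro Gamma_plus1) (auto elim!: nonpos_Ints_cases)
  ultimately show ?thesis using assms by (simp add: field_simps)
qed

text \<open>The first two steps are coupled, because the first one uses the interpolant on both cells.\<close>

lemma starting_values:
  fixes e :: "nat \<Rightarrow> real"
  assumes \<nu>: "0 < \<nu>" "\<nu> < 1" and h: "h > 0" and L: "0 < L" and hL: "h powr \<nu> * L \<le> 1 / 216"
    and e0: "e 0 = 0" and R: "0 \<le> R"
    and res: "\<And>j. j \<in> {1, 2} \<Longrightarrow> \<bar>caputo_discrete \<nu> h e j\<bar> \<le> L * \<bar>e j\<bar> + R"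
  shows "\<bar>e 1\<bar> \<le> 5 * (h powr \<nu> * R)" "\<bar>e 2\<bar> \<le> 5 * (h powr \<nu> * R)"
proof -
  define H where "H = h powr \<nu>"
  define A where "A = 2 * (1 - \<nu>) * (2 - \<nu>) * (Gamma (1 - \<nu>) * H)"
  define b where "b = 2 powr (1 - \<nu>)"
  define E where "E = max \<bar>e 1\<bar> \<bar>e 2\<bar>"
  have H: "0 < H" using h by (simp add: H_def)
  have b: "1 \<le> b" using \<nu> by (simp add: b_def ge_one_powr_ge_zero)
  define k where "k = 2 * (1 - \<nu>) * (2 - \<nu>)"
  have k: "0 < k" using \<nu> by (simp add: k_def)
  have A0: "0 \<le> A" using \<nu> H Gamma_real_pos[of "1 - \<nu>"] by (simp add: A_def)
  \<comment> \<open>\<open>A\<close> clears the denominators of the explicit weights. The factor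
    \<open>1 - \<nu>\<close> in it compensates the growth of Gamma, which makes the constants below
    independent of \<open>\<nu>\<close>.\<close>
  have "(1 - \<nu>) * Gamma (1 - \<nu>) \<le> 1" using Gamma_1_minus_le[OF \<nu>] \<nu> by (simp add: field_simps)
  then have "(2 * (2 - \<nu>) * H) * ((1 - \<nu>) * Gamma (1 - \<nu>)) \<le> (2 * (2 - \<nu>) * H) * 1"
    using H \<nu> by (intro mult_left_mono) auto
  also have "\<dots> \<le> 4 * H" using H \<nu> by simp
  also have "(2 * (2 - \<nu>) * H) * ((1 - \<nu>) * Gamma (1 - \<nu>)) = A" by (simp add: A_def algebra_simps)
  finally have A4: "A \<le> 4 * H" .
  have Ak: "A * x = k * (Gamma (1 - \<nu>) * H * x)" for x by (simp add: A_def k_def)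
  define a1 where "a1 = A * caputo_discrete \<nu> h e 1"
  define a2 where "a2 = A * caputo_discrete \<nu> h e 2 / b"
  have "Gamma (1 - \<nu>) * H * caputo_discrete \<nu> h e 1 = first_weight \<nu> 0 (e 1) (e 2 - e 1)"
    using caputo_discrete_eq_conv_diff[OF h \<nu>(2), of 1 e] e0 by (simp add: H_def conv_diff_def step_weight_def)
  also have "\<dots> = ((4 - 4 * \<nu>) * e 1 + \<nu> * e 2) / k"
    unfolding first_weight_0[OF \<nu>] k_def by (simp add: algebra_simps)
  finally have 1: "a1 = (4 - 4 * \<nu>) * e 1 + \<nu> * e 2"
    using k by (simp add: a1_def Ak)
  have "Gamma (1 - \<nu>) * H * caputo_discrete \<nu> h e 2 = right_weight \<nu> 0 * (e 2 - e 1) + left_weight \<nu> 0 * e 1"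
    using caputo_discrete_eq_conv_diff[OF h \<nu>(2), of 2 e] e0 by (simp add: H_def conv_diff_def step_weight_def numeral_2_eq_2)
  also have "\<dots> = b * ((2 + \<nu>) * e 2 - 4 * \<nu> * e 1) / k"
    unfolding right_weight_0[OF \<nu>] left_weight_0[OF \<nu>] k_def[symmetric] b_def[symmetric]
    by (simp add: algebra_simps diff_divide_distrib add_divide_distrib)
  finally have 2: "a2 = (2 + \<nu>) * e 2 - 4 * \<nu> * e 1"
    using k b by (simp add: a2_def Ak)
  define B where "B = 4 * H * (L * E + R)"
  have B: "A * \<bar>caputo_discrete \<nu> h e j\<bar> \<le> B" if "j \<in> {1, 2}" for j
  proof -
    have "\<bar>caputo_discrete \<nu> h e j\<bar> \<le> L * E + R"
    proof -
      have "L * \<bar>e j\<bar> \<le> L * E" using that L by (intro mult_left_mono) (auto simp: E_def)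
      then show ?thesis using res[OF that] by linarith
    qed
    then show ?thesis unfolding B_def using A0 A4 H by (intro mult_mono) auto
  qed
  have a1: "\<bar>a1\<bar> \<le> B" using B[of 1] A0 by (simp add: a1_def abs_mult)
  have "B \<ge> 0" using a1 by linarith
  have a2: "\<bar>a2\<bar> \<le> B"
  proof -
    have "\<bar>a2\<bar> = A * \<bar>caputo_discrete \<nu> h e 2\<bar> / b" using A0 b by (simp add: a2_def abs_mult)
    also have "\<dots> \<le> B / b" using B[of 2] b by (intro divide_right_mono) auto
    also have "\<dots> \<le> B / 1" using b \<open>B \<ge> 0\<close> by (intro divide_left_mono) auto
    finally show ?thesis by simp
  qed
  \<comment> \<open>Cramer's rule: the system for \<open>e 1\<close> and \<open>e 2\<close> with
    right-hand sides \<open>a1\<close> and \<open>a2\<close> has determinant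
    \<open>8 - 4 * \<nu>\<close>, which is at least 4.\<close>
  have "4 * \<bar>e 1\<bar> \<le> (8 - 4 * \<nu>) * \<bar>e 1\<bar>" using \<nu> by (intro mult_right_mono) auto
  also have "\<dots> = \<bar>(2 + \<nu>) * a1 - \<nu> * a2\<bar>"
  proof -
    have "(2 + \<nu>) * a1 - \<nu> * a2 = (8 - 4 * \<nu>) * e 1" by (simp add: 1 2 algebra_simps)
    then show ?thesis using \<nu> by (simp add: abs_mult)
  qed
  also have "\<dots> \<le> (2 + \<nu>) * B + \<nu> * B"
    using \<nu> a1 a2 by (intro order_trans[OF abs_triangle_ineq4] add_mono) (auto simp: abs_mult intro!: mult_mono)
  also have "\<dots> \<le> 4 * B" using \<nu> \<open>B \<ge> 0\<close> mult_right_mono[of "2 + \<nu> + \<nu>" 4 B] by (simp add: algebra_simps)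
  finally have e1: "\<bar>e 1\<bar> \<le> B" by simp
  have "4 * \<bar>e 2\<bar> \<le> (8 - 4 * \<nu>) * \<bar>e 2\<bar>" using \<nu> by (intro mult_right_mono) auto
  also have "\<dots> = \<bar>(4 - 4 * \<nu>) * a2 + 4 * \<nu> * a1\<bar>"
  proof -
    have "(4 - 4 * \<nu>) * a2 + 4 * \<nu> * a1 = (8 - 4 * \<nu>) * e 2" by (simp add: 1 2 algebra_simps)
    then show ?thesis using \<nu> by (simp add: abs_mult)
  qed
  also have "\<dots> \<le> (4 - 4 * \<nu>) * B + 4 * \<nu> * B"
    using \<nu> a1 a2 by (intro order_trans[OF abs_triangle_ineq] add_mono) (auto simp: abs_mult intro!: mult_mono)
  also have "\<dots> = 4 * B" by (simp add: algebra_simps)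
  finally have e2: "\<bar>e 2\<bar> \<le> B" by simp
  have "E \<le> B" using e1 e2 by (simp add: E_def)
  also have "B = 4 * ((H * L) * E) + 4 * (H * R)" by (simp add: B_def algebra_simps)
  \<comment> \<open>The step restriction lets the Lipschitz part, at most \<open>E / 54\<close>, be
    absorbed; what remains is below 5.\<close>
  also have "(H * L) * E \<le> 1 / 216 * E" using hL by (intro mult_right_mono) (auto simp: H_def E_def)
  finally have "E \<le> 4 * (1 / 216 * E) + 4 * (H * R)" by simp
  moreover have "0 \<le> H * R" using H R by simp
  ultimately have "E \<le> 5 * (H * R)" by linarith
  then show "\<bar>e 1\<bar> \<le> 5 * (h powr \<nu> * R)" "\<bar>e 2\<bar> \<le> 5 * (h powr \<nu> * R)"
    by (simp_all add: E_def H_def)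
qed

text \<open>The residual bound \<open>R\<close> passes to the error with a factor independent of
  \<open>h\<close> and \<open>J\<close>, apart from the exponential of the position
  \<open>h * real j\<close>.\<close>

lemma stability:
  fixes e :: "nat \<Rightarrow> real"
  assumes \<nu>: "0 < \<nu>" "\<nu> < 1" and h: "h > 0" and L: "0 < L" and hL: "h powr \<nu> * L \<le> 1 / 216"
    and e0: "e 0 = 0" and R: "0 \<le> R" and J: "2 \<le> J"
    and res: "\<And>j. 1 \<le> j \<Longrightarrow> j \<le> J \<Longrightarrow> \<bar>caputo_discrete \<nu> h e j\<bar> \<le> L * \<bar>e j\<bar> + R"
    and j: "j \<le> J"
  defines "\<Gamma> \<equiv> Gamma (1 - \<nu>)"
  shows "\<bar>e j\<bar> \<le> 3 * (\<Gamma> + 75 / (1 - \<nu>)) / (\<Gamma> * L) *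
     exp (6 * (8 * \<Gamma> * L) powr (1 / \<nu>) * (h * real j)) * R"
proof -
  define H where "H = h powr \<nu>"
  define a where "a = \<Gamma> * H * L"
  \<comment> \<open>\<open>\<mu>\<close> solves \<open>(6 / s) powr (- \<nu>) = 8 * a\<close> with
    \<open>s = \<mu> * h\<close>, an equation in which \<open>h\<close> cancels. The 6 absorbs the
    shift in \<open>M + 4 \<le> 6 / s\<close>. The 8 is twice \<open>3 + 1\<close>: 3 bounds
    \<open>1 / (1 - damping \<nu>)\<close>, 1 is for the residual, and the doubling offsets the 1/2
    in \<open>conv_diff_exp\<close>.\<close>
  define \<mu> where "\<mu> = 6 * (8 * \<Gamma> * L) powr (1 / \<nu>)"
  define s where "s = \<mu> * h"
  define M where "M = nat \<lceil>1 / s\<rceil>"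
  define v where "v n = exp (s * real n)" for n :: nat
  define F where "F = H * R * (\<Gamma> + 75 / (1 - \<nu>))"
  define K where "K = R * (\<Gamma> + 75 / (1 - \<nu>)) / (\<Gamma> * L)"
  define w where "w i = (case i of 0 \<Rightarrow> 0 | Suc i' \<Rightarrow> e (Suc i') - damping \<nu> * e i')" for i
  have w: "w 0 = 0" "w (Suc i) = e (Suc i) - damping \<nu> * e i" for i by (simp_all add: w_def)
  have \<Gamma>0: "0 < \<Gamma>" unfolding \<Gamma>_def using \<nu> by (intro Gamma_real_pos) auto
  have H: "0 < H" using h by (simp add: H_def)
  have a: "0 < a" using \<Gamma>0 H L by (simp add: a_def)
  have \<mu>: "0 < \<mu>" using \<Gamma>0 L by (simp add: \<mu>_def)
  have s: "0 < s" using \<mu> h by (simp add: s_def)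
  have "1 / s \<le> real M" unfolding M_def by (simp add: real_nat_ceiling_ge)
  then have sM: "1 \<le> s * real M" using s by (simp add: field_simps)
  have M1: "1 \<le> M" using sM s by (cases M) auto
  have \<eta>: "0 \<le> damping \<nu>" "damping \<nu> < 1" "1 / (1 - damping \<nu>) \<le> 3" using damping_bounds[OF \<nu>] .
  have \<phi>0: "0 \<le> quotient_weight \<nu> k" for k using quotient_weight_ge[OF \<nu>, of k] by (rule order_trans[rotated]) simp
  \<comment> \<open>If \<open>M = 1\<close>, then \<open>s \<ge> 1\<close> and the power bound may
    be too weak; the step restriction is then compared with the exact first weight. Otherwise
    \<open>1 / s > 1\<close>, so \<open>M + 4 < 1 / s + 5 \<le> 6 / s\<close>.\<close>
  have a\<phi>: "8 * a \<le> quotient_weight \<nu> (M - 1)"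
  proof (cases "M = 1")
    case True
    have "8 * a = 8 * (H * L) * \<Gamma>" by (simp add: a_def)
    also have "\<dots> \<le> 8 * (1 / 216) * (1 / (1 - \<nu>))"
      using hL H L \<Gamma>0 Gamma_1_minus_le[OF \<nu>] by (intro mult_mono) (auto simp: H_def \<Gamma>_def)
    also have "\<dots> \<le> 1 * 2 / (2 * (1 - \<nu>) * 2)" using \<nu> by (simp add: field_simps)
    also have "\<dots> \<le> 2 powr (1 - \<nu>) * (2 + \<nu>) / (2 * (1 - \<nu>) * (2 - \<nu>))"
      using \<nu> by (intro frac_le mult_mono mult_left_mono) (auto simp: ge_one_powr_ge_zero)
    also have "\<dots> = quotient_weight \<nu> (M - 1)" using True right_weight_0[OF \<nu>] by (simp add: step_weight_def)
    finally show ?thesis .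
  next
    case False
    have "real M < 1 / s + 1" unfolding M_def using s by (simp add: of_nat_ceiling) linarith
    moreover have "2 \<le> real M" using False M1 by simp
    ultimately have "real (M - 1 + 5) \<le> 6 / s" using M1 by (simp add: of_nat_diff) 
    then have "(6 / s) powr (- \<nu>) \<le> real (M - 1 + 5) powr (- \<nu>)"
      using \<nu> by (intro powr_mono2') auto
    also have "\<dots> \<le> quotient_weight \<nu> (M - 1)" by (rule quotient_weight_ge[OF \<nu>])
    finally have "(6 / s) powr (- \<nu>) \<le> quotient_weight \<nu> (M - 1)" .
    moreover have "(6 / s) powr (- \<nu>) = 8 * a"
    proof -
      have "(6 / s) powr (- \<nu>) = (s / 6) powr \<nu>"
        using s by (simp add: powr_minus inverse_powr[symmetric])
      also have "s / 6 = (8 * \<Gamma> * L) powr (1 / \<nu>) * h" by (simp add: s_def \<mu>_def)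
      also have "\<dots> powr \<nu> = (8 * \<Gamma> * L) * H"
        using h \<Gamma>0 L \<nu> by (simp add: powr_mult powr_powr H_def)
      finally show ?thesis by (simp add: a_def)
    qed
    ultimately show ?thesis by simp
  qed
  have start: "\<bar>e 1\<bar> \<le> 5 * (H * R)" "\<bar>e 2\<bar> \<le> 5 * (H * R)"
    unfolding H_def by (rule starting_values[where e = e, OF \<nu> h L hL e0 R], use res J in fastforce)+
  have eq: "\<bar>conv_diff (quotient_weight \<nu>) w i\<bar> \<le> a * \<bar>e i\<bar> + F" if i: "1 \<le> i" "i \<le> J" for i
  proof -
    let ?c = "if odd i then first_weight \<nu> (real (i - 1)) (e 1 - e 0) (e 2 - e 1) - right_weight \<nu> (real (i - 1)) * (e 1 - e 0) else 0"
    have "conv_diff (quotient_weight \<nu>) w i = conv_diff (step_weight \<nu>) e i"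
      by (rule conv_diff_quotient[symmetric, where \<eta> = "damping \<nu>"]) (simp_all add: w e0)
    also have "\<dots> = \<Gamma> * H * caputo_discrete \<nu> h e i - ?c"
      using caputo_discrete_eq_conv_diff[OF h \<nu>(2) i(1), of e] by (simp add: H_def \<Gamma>_def)
    finally have "\<bar>conv_diff (quotient_weight \<nu>) w i\<bar> \<le> \<bar>\<Gamma> * H * caputo_discrete \<nu> h e i\<bar> + \<bar>?c\<bar>"
      by (simp only: abs_triangle_ineq4)
    also have "\<bar>\<Gamma> * H * caputo_discrete \<nu> h e i\<bar> \<le> \<Gamma> * H * (L * \<bar>e i\<bar> + R)"
      using res[OF i] \<Gamma>0 H by (simp add: abs_mult)
    \<comment> \<open>The first increment is at most 5 and the second at most 10 times
      \<open>H * R\<close>; the resulting 75 enters \<open>F\<close> and \<open>K\<close>.\<close>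
    also have "\<bar>?c\<bar> \<le> 5 / (1 - \<nu>) * (15 * (H * R))"
    proof -
      have "\<bar>?c\<bar> \<le> 5 / (1 - \<nu>) * (\<bar>e 1 - e 0\<bar> + \<bar>e 2 - e 1\<bar>)"
        using abs_first_weight_minus_right_weight_le[OF \<nu>, of "real (i - 1)"] \<nu> by simp
      also have "\<dots> \<le> 5 / (1 - \<nu>) * (15 * (H * R))"
        using start e0 \<nu> by (intro mult_left_mono) auto
      finally show ?thesis .
    qed
    finally show ?thesis by (simp add: a_def F_def algebra_simps)
  qed
  have "\<bar>w j\<bar> \<le> K * v j \<and> \<bar>e j\<bar> \<le> K * v j / (1 - damping \<nu>)"
  proof (rule conv_diff_comparison[where \<phi> = "quotient_weight \<nu>" and a = a and \<epsilon> = a and F = F and J = J])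
    show "mono v" using s by (auto simp: v_def intro!: monoI)
    show "a < quotient_weight \<nu> 0"
    proof -
      have "quotient_weight \<nu> (M - 1) \<le> quotient_weight \<nu> 0"
        by (rule lift_Suc_antimono_le[of "quotient_weight \<nu>", OF quotient_weight_Suc_le[OF \<nu>]]) simp
      then show ?thesis using a\<phi> a by simp
    qed
    show "0 \<le> K" using R \<Gamma>0 L \<nu> by (simp add: K_def)
    show "F \<le> K * a" using \<Gamma>0 L by (simp add: F_def K_def a_def)
    show "(a / (1 - damping \<nu>) + a) * v i \<le> conv_diff (quotient_weight \<nu>) v i + quotient_weight \<nu> (i - 1) * v 0" if "1 \<le> i" for i
    proof -
      have "a * (1 / (1 - damping \<nu>)) \<le> a * 3" using \<eta> a by (intro mult_left_mono) auto
      then have "a / (1 - damping \<nu>) \<le> a * 3" by simp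
      then have "a / (1 - damping \<nu>) + a \<le> quotient_weight \<nu> (M - 1) / 2" using a\<phi> by linarith
      then have "(a / (1 - damping \<nu>) + a) * v i \<le> quotient_weight \<nu> (M - 1) / 2 * v i"
        by (intro mult_right_mono) (auto simp: v_def)
      also have "\<dots> \<le> conv_diff (quotient_weight \<nu>) v i + quotient_weight \<nu> (i - 1) * v 0"
        unfolding v_def[abs_def] using s by (intro conv_diff_exp quotient_weight_Suc_le[OF \<nu>] \<phi>0 M1 sM that) auto
      finally show ?thesis .
    qed
  qed (use quotient_weight_Suc_le[OF \<nu>] \<eta> e0 a eq j w in \<open>simp_all add: v_def\<close>)
  then have "\<bar>e j\<bar> \<le> (K * v j) * (1 / (1 - damping \<nu>))" by simp
  also have "\<dots> \<le> (K * v j) * 3"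
    using \<eta> R \<Gamma>0 L \<nu> by (intro mult_left_mono) (auto simp: K_def v_def)
  finally show ?thesis
    unfolding K_def v_def s_def \<mu>_def by (simp only: mult_ac times_divide_eq_left times_divide_eq_right)
qed

theorem theorem4p8:
  fixes \<nu> T L :: real and y :: "real \<Rightarrow> real"
  assumes "0 < \<nu>" "\<nu> < 1" "T > 0" "L > 0"
    and "C_k_on 3 y {0..T}"
  shows "\<exists>K::real. \<forall>(f :: real \<Rightarrow> real \<Rightarrow> real) (y0 :: real).
           (\<forall>x\<in>{0..T}. \<forall>u v. \<bar>f x u - f x v\<bar> \<le> L * \<bar>u - v\<bar>) \<longrightarrow>
           (\<forall>x\<in>{0<..T}. caputo \<nu> y x = f x (y x)) \<longrightarrow> y 0 = y0 \<longrightarrow>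
           (\<forall>(N :: nat) (h :: real) (z :: nat \<Rightarrow> real).
              N > 0 \<longrightarrow> h = T / (2 * real N) \<longrightarrow> h powr \<nu> \<le> 1 / (24 * pi_B * L) \<longrightarrow>
              numerical_solution \<nu> f y0 h N z \<longrightarrow>
              (\<forall>k\<in>{1..2 * N}. \<bar>y (grid h k) - z k\<bar> \<le> K * h powr (3 - \<nu>)))"
proof -
  note \<nu> = assms(1,2)
  obtain D where D0: "D 0 = y"
    and D: "\<And>n s. n < 3 \<Longrightarrow> s \<in> {0..T} \<Longrightarrow> (D n has_real_derivative D (Suc n) s) (at s within {0..T})"
    and Dc: "continuous_on {0..T} (D 3)"
    using assms(5) unfolding C_k_on_def by blast
  have "bounded (D 3 ` {0..T})"
    using Dc by (intro compact_imp_bounded compact_continuous_image) auto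
  then obtain M where "\<forall>s\<in>{0..T}. \<bar>D 3 s\<bar> \<le> M"
    unfolding bounded_iff by auto
  then have M: "\<And>s. s \<in> {0..T} \<Longrightarrow> \<bar>D 3 s\<bar> \<le> M" by blast
  define \<Gamma> where "\<Gamma> = Gamma (1 - \<nu>)"
  define C where "C = 4 * M * 2 powr (1 - \<nu>) * (2 - \<nu>) / ((1 - \<nu>) * \<Gamma>)"
  define S where "S = 3 * (\<Gamma> + 75 / (1 - \<nu>)) / (\<Gamma> * L)"
  define \<mu> where "\<mu> = 6 * (8 * \<Gamma> * L) powr (1 / \<nu>)"
  have \<Gamma>0: "0 < \<Gamma>" unfolding \<Gamma>_def using \<nu> by (intro Gamma_real_pos) auto
  have M0: "0 \<le> M" using M[of 0] \<open>T > 0\<close> by auto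
  have C0: "0 \<le> C" using M0 \<Gamma>0 \<nu> by (simp add: C_def)
  have S0: "0 \<le> S" using \<Gamma>0 \<nu> \<open>L > 0\<close> by (simp add: S_def)
  show ?thesis
  \<comment> \<open>The constant is the product of the stability factor at \<open>x = T\<close> and
    the truncation constant. It depends on \<open>y\<close> only through the bound \<open>M\<close>
    for its third derivative, and neither \<open>f\<close> nor \<open>h\<close> enters.\<close>
  proof (intro exI[of _ "S * exp (\<mu> * T) * C"] allI impI ballI)
    fix f y0 N h z k
    assume lip: "\<forall>x\<in>{0..T}. \<forall>u v. \<bar>f x u - f x v\<bar> \<le> L * \<bar>u - v\<bar>"
      and sol: "\<forall>x\<in>{0<..T}. caputo \<nu> y x = f x (y x)" and y0: "y 0 = y0"
      and N: "0 < N" and hdef: "h = T / (2 * real N)" and hsmall: "h powr \<nu> \<le> 1 / (24 * pi_B * L)"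
      and num: "numerical_solution \<nu> f y0 h N z" and k: "k \<in> {1..2 * N}"
    have h: "0 < h" using \<open>T > 0\<close> N by (simp add: hdef)
    have gT: "grid h j \<in> {0<..T}" if "1 \<le> j" "j \<le> 2 * N" for j
    proof -
      have "real j * h \<le> real (2 * N) * h" using that h by (intro mult_right_mono) auto
      also have "\<dots> = T" using N by (simp add: hdef)
      finally show ?thesis using that h by (simp add: grid_def)
    qed
    define R where "R = C * h powr (3 - \<nu>)"
    have R: "0 \<le> R" using C0 by (simp add: R_def)
    define e where "e j = y (grid h j) - z j" for j
    have "\<bar>e k\<bar> \<le> 3 * (Gamma (1 - \<nu>) + 75 / (1 - \<nu>)) / (Gamma (1 - \<nu>) * L) *
       exp (6 * (8 * Gamma (1 - \<nu>) * L) powr (1 / \<nu>) * (h * real k)) * R"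
    proof (rule stability[OF \<nu> h \<open>L > 0\<close>])
      show "h powr \<nu> * L \<le> 1 / 216" using hsmall \<open>L > 0\<close> by (simp add: pi_B_def field_simps)
      show "e 0 = 0" using num y0 by (simp add: e_def numerical_solution_def grid_def)
      show "0 \<le> R" by (rule R)
      show "2 \<le> 2 * N" using N by simp
      show "k \<le> 2 * N" using k by simp
      fix j assume j: "1 \<le> j" "j \<le> 2 * N"
      let ?x = "grid h j"
      have "caputo_discrete \<nu> h z j = f ?x (z j)" using num j by (simp add: numerical_solution_def)
      \<comment> \<open>Adding and subtracting the exact derivative splits the residual into the
        truncation error and a difference of values of \<open>f\<close>, to which the Lipschitz
        condition applies.\<close>
      then have "caputo_discrete \<nu> h e j =
          (caputo_discrete \<nu> h (\<lambda>k. y (grid h k)) j - caputo \<nu> y ?x) + (f ?x (y ?x) - f ?x (z j))"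
        using sol gT[OF j] caputo_discrete_diff[OF h \<nu>(2), of "\<lambda>k. y (grid h k)" z j] by (simp add: e_def[abs_def])
      also have "\<bar>\<dots>\<bar> \<le> R + L * \<bar>e j\<bar>"
      proof (rule order_trans[OF abs_triangle_ineq add_mono])
        show "\<bar>caputo_discrete \<nu> h (\<lambda>k. y (grid h k)) j - caputo \<nu> y ?x\<bar> \<le> R"
          using truncation_error[OF \<nu> h j(1) _ _ D M] gT[OF j] gT[of 2] N by (simp add: R_def C_def \<Gamma>_def D0)
        show "\<bar>f ?x (y ?x) - f ?x (z j)\<bar> \<le> L * \<bar>e j\<bar>"
          using lip gT[OF j] by (simp add: e_def)
      qed
      finally show "\<bar>caputo_discrete \<nu> h e j\<bar> \<le> L * \<bar>e j\<bar> + R" by simp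
    qed
    also have "\<dots> = S * exp (\<mu> * grid h k) * R" by (simp add: S_def \<mu>_def \<Gamma>_def grid_def mult_ac)
    also have "\<dots> \<le> S * exp (\<mu> * T) * R"
      using gT[of k] k S0 R by (intro mult_right_mono mult_left_mono) (auto simp: \<mu>_def intro!: mult_left_mono)
    finally show "\<bar>y (grid h k) - z k\<bar> \<le> S * exp (\<mu> * T) * C * h powr (3 - \<nu>)"
      by (simp add: e_def R_def mult_ac)
  qed
qed

end
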